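(* Let $X^\delta=\sum_{\lambda\in\vee_\Sigma}\sigma_\lambda\otimes W_\lambda^\delta$, with subspaces $W_\lambda^\delta\subseteq V$ of which finitely many are non-zero, satisfy the tree condition $$\tilde\lambda\triangleleft_\Sigma\lambda\ \Longrightarrow\ W_{\tilde\lambda}^\delta\supseteq W_\lambda^\delta .$$ For $\mu\in\vee_\Psi$, set $$\breve W_\mu^\delta:=\sum_{\{\lambda\in\vee_\Sigma:\ |\lambda|=|\mu|,\ |\mathcal S_\Psi(\mu)\cap\mathcal S_\Sigma(\lambda)|>0\}}W_\lambda^\delta .$$ Build $Y^\delta=\sum_{\mu\in\vee_\Psi}\psi_\mu\otimes V_\mu^\delta$ by taking $V_\mu^\delta=\{0\}$ when $\breve W_\mu^\delta=\{0\}$, and otherwise $V\supseteq V_\mu^\delta\supseteq\breve W_\mu^\delta$ where $$\inf_{0\ne w\in\breve W_\mu^\delta}\ \sup_{0\ne v\in V_\mu^\delta}\frac{w(v)}{\|w\|_{V'}\|v\|_V}\ge\gamma_\Delta$$ for some constant $\gamma_\Delta>0$. Then: (i) for all $\lambda\in\vee_\Sigma$, $\mu\in\vee_\Psi$: $\langle\sigma_\lambda,\psi_\mu\rangle_{L_2(I)}\ne0\Longrightarrow V_\mu^\delta\supseteq W_\lambda^\delta$; and for any $\mu\in\vee_\Psi$, $$\inf_{0\ne w\in\sum_{\{\lambda\in\vee_\Sigma:\langle\sigma_\lambda',\psi_\mu\rangle_{L_2(I)}\ne0\}}W_\lambda^\delta}\ \sup_{0\ne v\in V_\mu^\delta}\frac{w(v)}{\|w\|_{V'}\|v\|_V}\ge\gamma_\Delta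 .$$ (ii) When $\dim V_\mu^\delta\lesssim\dim\breve W_\mu^\delta$, then $\dim Y^\delta\lesssim\dim X^\delta$. (iii) Under the condition that a larger $\breve W_\mu^\delta$ gives rise to a larger (more precisely, not smaller) $V_\mu^\delta$ (i.e. $\breve W_{\mu}^\delta\subseteq\breve W_{\tilde\mu}^\delta$ implies $V_{\mu}^\delta\subseteq V_{\tilde\mu}^\delta$), the constructed $Y^\delta$ satisfies the tree condition $$\tilde\mu\triangleleft_\Psi\mu\ \Longrightarrow\ V_{\tilde\mu}^\delta\supseteq V_\mu^\delta .$$
   Context: $I=(0,1)$, $\Omega\subset\mathbb R^d$ is a bounded domain, $H=L_2(\Omega)$, $V=H^1_{0,\Gamma_D}(\Omega)$ (closure in $H^1(\Omega)$ of the functions in $C^\infty(\Omega)\cap H^1(\Omega)$ vanishing on the closed set $\Gamma_D\subseteq\partial\Omega$), with $V\hookrightarrow H\simeq H'\hookrightarrow V'$; for $w\in V$ regarded as an element of $V'$, $w(v)=\langle w,v\rangle_{L_2(\Omega)}$. Infima over empty sets are $+\infty$. **Wavelets at the trial side.** $\Sigma=\{\sigma_\lambda:\lambda\in\vee_\Sigma\}$ is a countable collection of functions $I\to\mathbb R$; each $\lambda$ has a level $|\lambda|\in\mathbb N_0$. Local support: $\sup_{n\in\mathbb N,\ell\in\mathbb N_0}\#\{\lambda\in\vee_\Sigma:|\lambda|=\ell,\ |\mathrm{supp}\,\sigma_\lambda\cap2^{-\ell}(n+[0,1])|>0\}<\infty$ and $\mathrm{diam}\,\mathrm{supp}\,\sigma_\lambda\lesssim2^{-|\lambda|}$.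 To each $\lambda$ with $|\lambda|>0$ are associated one or more parents $\tilde\lambda\in\vee_\Sigma$, with $|\tilde\lambda|=|\lambda|-1$ and $|\mathrm{supp}\,\sigma_\lambda\cap\mathrm{supp}\,\sigma_{\tilde\lambda}|>0$; this relation is written $\tilde\lambda\triangleleft_\Sigma\lambda$. To each $\lambda$ is associated a neighbourhood $\mathcal S_\Sigma(\lambda)$ of $\mathrm{supp}\,\sigma_\lambda$ with $\mathrm{diam}\,\mathcal S_\Sigma(\lambda)\lesssim2^{-|\lambda|}$ and $\tilde\lambda\triangleleft_\Sigma\lambda\Rightarrow\mathcal S_\Sigma(\tilde\lambda)\supseteq\mathcal S_\Sigma(\lambda)$. $\Sigma$ is a Riesz basis for $L_2(I)$ and, renormalized in $H^1(I)$-norm, a Riesz basis for $H^1(I)$, with $\|\sigma_\lambda\|_{H^1(I)}\eqsim2^{|\lambda|}$. **Wavelets at the test side.** $\Psi=\{\psi_\mu:\mu\in\vee_\Psi\}$ is a similar collection (levels $|\mu|$, local supports, parent relation $\triangleleft_\Psi$, neighbourhoods $\mathcal S_\Psi(\mu)$ with the same properties), except that $\Psi$ is an orthonormal basis of $L_2(I)$ and its elements need not be in $H^1(I)$. **Relation.** For any $\ell\in\mathbb N_0$, $\mathrm{span}\{\sigma_\lambda:|\lambda|\le\ell\}\cup\mathrm{span}\{\sigma_\lambda':|\lambda|\le\ell\}\subseteq\mathrm{span}\{\psi_\mu:|\mu|\le\ell\}$; in particular $|\mu|>|\lambda|$ implies $\langle\sigma_\lambda,\psi_\mu\rangle_{L_2(I)}=0=\langle\sigma_\lambda',\psi_\mu\rangle_{L_2(I)}$.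 Here $|\cdot|$ of a subset of $I$ is Lebesgue measure, $\sigma_\lambda'$ is the derivative of $\sigma_\lambda$, and $C\lesssim D$ means $C$ is bounded by a multiple of $D$ with a constant independent of parameters such as $\lambda,\mu,\delta$ on which $C,D$ may depend ($C\eqsim D$: both directions).
   Formalization: In the local support condition the supremum over n is taken to include n=0, so that the intervals 2^{-ℓ}(n+[0,1]) cover I; with n≥1 only, infinitely many ψ_μ could sit at level 0 and (ii) would fail. *)

theory Defs
  imports "HOL-Analysis.Analysis"
begin

section \<open>Functions modulo equality almost everywhere\<close>

definition ae_eq :: "('a::euclidean_space \<Rightarrow> real) \<Rightarrow> ('a \<Rightarrow> real) \<Rightarrow> bool" where
  "ae_eq f g \<longleftrightarrow> (AE x in lebesgue. f x = g x)"

text \<open>Measurability is not part of this type: it is imposed in \<open>L2\<close> below.\<close>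

quotient_type (overloaded) 'a aefun = "'a::euclidean_space \<Rightarrow> real" / ae_eq
proof (rule equivpI)
  show "reflp ae_eq" by (simp add: reflp_def ae_eq_def)
  show "symp ae_eq" by (auto simp: symp_def ae_eq_def elim: AE_mp)
  show "transp ae_eq"
    unfolding transp_def ae_eq_def by (metis (mono_tags, lifting) AE_mp AE_I2)
qed

instantiation aefun :: (euclidean_space) real_vector
begin

lift_definition zero_aefun :: "'a aefun" is "\<lambda>x. 0" .

lift_definition plus_aefun :: "'a aefun \<Rightarrow> 'a aefun \<Rightarrow> 'a aefun" is "\<lambda>f g x. f x + g x"
  unfolding ae_eq_def by (elim AE_mp) auto

lift_definition minus_aefun :: "'a aefun \<Rightarrow> 'a aefun \<Rightarrow> 'a aefun" is "\<lambda>f g x. f x - g x"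
  unfolding ae_eq_def by (elim AE_mp) auto

lift_definition uminus_aefun :: "'a aefun \<Rightarrow> 'a aefun" is "\<lambda>f x. - f x"
  unfolding ae_eq_def by (elim AE_mp) auto

lift_definition scaleR_aefun :: "real \<Rightarrow> 'a aefun \<Rightarrow> 'a aefun" is "\<lambda>c f x. c * f x"
  unfolding ae_eq_def by (elim AE_mp) auto

instance
  by standard (transfer; simp add: ae_eq_def algebra_simps)+

end

lemma integral_lebesgue_cong_ae_eq:
  assumes "ae_eq f g"
  shows "(\<integral>x. f x \<partial>lebesgue) = (\<integral>x. g x \<partial>lebesgue)"
proof -
  have "ae_eq g f"
    using assms unfolding ae_eq_def by (elim AE_mp) auto
  show ?thesis
  proof (cases "f \<in> borel_measurable lebesgue")
    case True
    moreover have "g \<in> borel_measurable lebesgue"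
      using borel_measurable_AE[OF True] assms by (simp add: ae_eq_def)
    ultimately show ?thesis
      using assms by (intro integral_cong_AE) (auto simp: ae_eq_def)
  next
    case False
    moreover have "g \<notin> borel_measurable lebesgue"
      using borel_measurable_AE[of g f] \<open>ae_eq g f\<close> False by (auto simp: ae_eq_def)
    ultimately show ?thesis
      by (metis borel_measurable_integrable not_integrable_integral_eq)
  qed
qed

lemma AE_lebesgue_fst:
  assumes "AE t in lebesgue. P (t::'a::euclidean_space)"
  shows "AE z in (lebesgue :: ('a \<times> 'b::euclidean_space) measure). P (fst z)"
proof -
  from assms have "AE t in lborel. P t"
    by (simp only: AE_completion_iff)
  then obtain N where N: "N \<in> null_sets lborel" "{t. \<not> P t} \<subseteq> N"
    unfolding eventually_ae_filter by auto
  have "N \<times> (UNIV :: 'b set) \<in> null_sets (lborel \<Otimes>\<^sub>M lborel)"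
    using N(1) by (intro lborel.times_in_null_sets1) auto
  then have "N \<times> (UNIV :: 'b set) \<in> null_sets lborel"
    by (simp add: lborel_prod)
  then have "AE z in (lborel :: ('a \<times> 'b) measure). P (fst z)"
    by (rule AE_I') (use N(2) in auto)
  then show ?thesis by (rule AE_completion)
qed

lemma AE_lebesgue_snd:
  assumes "AE x in lebesgue. P (x::'b::euclidean_space)"
  shows "AE z in (lebesgue :: ('a::euclidean_space \<times> 'b) measure). P (snd z)"
proof -
  from assms have "AE t in lborel. P t"
    by (simp only: AE_completion_iff)
  then obtain N where N: "N \<in> null_sets lborel" "{t. \<not> P t} \<subseteq> N"
    unfolding eventually_ae_filter by auto
  have "(UNIV :: 'a set) \<times> N \<in> null_sets (lborel \<Otimes>\<^sub>M lborel)"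
    using N(1) by (intro lborel.times_in_null_sets2) auto
  then have "(UNIV :: 'a set) \<times> N \<in> null_sets lborel"
    by (simp add: lborel_prod)
  then have "AE z in (lborel :: ('a \<times> 'b) measure). P (snd z)"
    by (rule AE_I') (use N(2) in auto)
  then show ?thesis by (rule AE_completion)
qed

lift_definition l2_inner :: "'a::euclidean_space aefun \<Rightarrow> 'a aefun \<Rightarrow> real"
  is "\<lambda>f g. \<integral>x. f x * g x \<partial>lebesgue"
  by (rule integral_lebesgue_cong_ae_eq, unfold ae_eq_def, elim AE_mp) auto

lift_definition tensor :: "real aefun \<Rightarrow> 'a::euclidean_space aefun \<Rightarrow> (real \<times> 'a) aefun"
  is "\<lambda>f g (t, x). f t * g x"
proof -
  fix f f' :: "real \<Rightarrow> real" and g g' :: "'a \<Rightarrow> real"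
  assume "ae_eq f f'" "ae_eq g g'"
  then have "AE z in (lebesgue :: (real \<times> 'a) measure). f (fst z) = f' (fst z)"
    and "AE z in (lebesgue :: (real \<times> 'a) measure). g (snd z) = g' (snd z)"
    unfolding ae_eq_def by (auto intro: AE_lebesgue_fst AE_lebesgue_snd)
  then show "ae_eq (\<lambda>(t, x). f t * g x) (\<lambda>(t, x). f' t * g' x)"
    unfolding ae_eq_def by (elim AE_mp) auto
qed

text \<open>
  A function on \<open>S\<close> is identified with its extension by zero; in this way \<open>L\<^sub>2(S)\<close>,
  its subspaces, and the algebraic tensor products in \<open>L\<^sub>2(I \<times> \<Omega>)\<close> are subspaces of
  the vector spaces \<^typ>\<open>'a aefun\<close>.
\<close>

definition class_on :: "'a set \<Rightarrow> ('a::euclidean_space \<Rightarrow> real) \<Rightarrow> 'a aefun" where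
  "class_on S f = abs_aefun (\<lambda>x. if x \<in> S then f x else 0)"

definition L2 :: "'a::euclidean_space set \<Rightarrow> 'a aefun set" where
  "L2 S = {class_on S f | f. f \<in> borel_measurable (lebesgue_on S) \<and>
                             integrable (lebesgue_on S) (\<lambda>x. (f x)\<^sup>2)}"

definition l2_norm :: "'a::euclidean_space aefun \<Rightarrow> real" where
  "l2_norm u = sqrt (l2_inner u u)"


section \<open>Sobolev spaces\<close>

definition partial_deriv :: "'a \<Rightarrow> ('a::euclidean_space \<Rightarrow> real) \<Rightarrow> 'a \<Rightarrow> real" where
  "partial_deriv b f x = frechet_derivative f (at x) b"

text \<open>\<open>C\<^sup>\<infinity>(S)\<close> for open \<open>S\<close>: all iterated partial derivatives are differentiable on \<open>S\<close>.\<close>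

definition smooth_on :: "'a::euclidean_space set \<Rightarrow> ('a \<Rightarrow> real) \<Rightarrow> bool" where
  "smooth_on S f \<longleftrightarrow> (\<forall>bs \<in> lists Basis. foldr partial_deriv bs f differentiable_on S)"

definition test_function :: "'a::euclidean_space set \<Rightarrow> ('a \<Rightarrow> real) \<Rightarrow> bool" where
  "test_function S \<phi> \<longleftrightarrow>
     smooth_on UNIV \<phi> \<and> (\<exists>K. compact K \<and> K \<subseteq> S \<and> (\<forall>x. x \<notin> K \<longrightarrow> \<phi> x = 0))"

definition is_weak_deriv ::
  "'a::euclidean_space set \<Rightarrow> 'a \<Rightarrow> 'a aefun \<Rightarrow> 'a aefun \<Rightarrow> bool" where
  "is_weak_deriv S b u g \<longleftrightarrow>
     (\<forall>\<phi>. test_function S \<phi> \<longrightarrow>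
        l2_inner u (class_on S (partial_deriv b \<phi>)) = - l2_inner g (class_on S \<phi>))"

definition H1 :: "'a::euclidean_space set \<Rightarrow> 'a aefun set" where
  "H1 S = {u \<in> L2 S. \<forall>b\<in>Basis. \<exists>g\<in>L2 S. is_weak_deriv S b u g}"

definition weak_deriv :: "'a::euclidean_space set \<Rightarrow> 'a \<Rightarrow> 'a aefun \<Rightarrow> 'a aefun" where
  "weak_deriv S b u = (THE g. g \<in> L2 S \<and> is_weak_deriv S b u g)"

definition H1_norm :: "'a::euclidean_space set \<Rightarrow> 'a aefun \<Rightarrow> real" where
  "H1_norm S u = sqrt ((l2_norm u)\<^sup>2 + (\<Sum>b\<in>Basis. (l2_norm (weak_deriv S b u))\<^sup>2))"

text \<open>
  \<open>H\<^sup>1\<^sub>0\<^sub>,\<^sub>\<Gamma>(S)\<close>. A function in \<open>C\<^sup>\<infinity>(S)\<close> has no values on \<open>\<Gamma> \<subseteq> \<partial>S\<close>; that it vanishes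
  there means that it tends to zero at every point of \<open>\<Gamma>\<close>.
\<close>

definition H1_0 :: "'a::euclidean_space set \<Rightarrow> 'a set \<Rightarrow> 'a aefun set" where
  "H1_0 S \<Gamma> = {u \<in> H1 S. \<forall>\<epsilon>>0. \<exists>f. smooth_on S f \<and> class_on S f \<in> H1 S \<and>
                  (\<forall>y\<in>\<Gamma>. (f \<longlongrightarrow> 0) (at y within S)) \<and> H1_norm S (u - class_on S f) < \<epsilon>}"

text \<open>The norm in \<open>V'\<close> of the functional \<open>v \<mapsto> \<langle>w, v\<rangle>\<close>, where \<open>V = H1_0 S \<Gamma>\<close>.\<close>

definition dual_norm :: "'a::euclidean_space set \<Rightarrow> 'a set \<Rightarrow> 'a aefun \<Rightarrow> real" where
  "dual_norm S \<Gamma> w = (SUP v \<in> H1_0 S \<Gamma> - {0}. \<bar>l2_inner w v\<bar> / H1_norm S v)"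

text \<open>Valued in \<^typ>\<open>ereal\<close>, so that the infimum over the empty set is \<open>+\<infinity>\<close>.\<close>

definition inf_sup ::
  "'a::euclidean_space set \<Rightarrow> 'a set \<Rightarrow> 'a aefun set \<Rightarrow> 'a aefun set \<Rightarrow> ereal" where
  "inf_sup S \<Gamma> W U =
     (INF w \<in> W - {0}. SUP v \<in> U - {0}.
        ereal (l2_inner w v / (dual_norm S \<Gamma> w * H1_norm S v)))"


section \<open>Wavelets in time\<close>

definition unit_I :: "real set" where
  "unit_I = {0<..<1}"

text \<open>The support as a subset of the open interval \<open>I\<close>.\<close>

definition supp_I :: "(real \<Rightarrow> real) \<Rightarrow> real set" where
  "supp_I f = unit_I \<inter> closure {t \<in> unit_I. f t \<noteq> 0}"

text \<open>
  Levels \<open>lev\<close>, parent relation \<open>par\<close> (\<open>par p l\<close> means that \<open>p\<close> is a parent of \<open>l\<close>),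
  neighbourhoods \<open>N\<close>. As \<open>I\<close> is open and \<open>supp_I f \<subseteq> I\<close>, neighbourhoods relative to \<open>I\<close>
  and relative to \<open>\<real>\<close> agree. Boundedness is stated separately because \<^const>\<open>diameter\<close>
  is meaningless for unbounded sets. The dyadic intervals in the first clause include
  those with \<open>n = 0\<close>, so that for every level they cover \<open>I\<close>.
\<close>

definition wavelet_collection ::
  "('l::countable \<Rightarrow> nat) \<Rightarrow> ('l \<Rightarrow> real \<Rightarrow> real) \<Rightarrow> ('l \<Rightarrow> 'l \<Rightarrow> bool) \<Rightarrow> ('l \<Rightarrow> real set) \<Rightarrow> bool"
where
  "wavelet_collection lev f par N \<longleftrightarrow>
     (\<exists>M. \<forall>(n::nat) k.
        let A = {l. lev l = k \<and>
                    emeasure lebesgue (supp_I (f l) \<inter> {real n / 2 ^ k .. (real n + 1) / 2 ^ k}) > 0}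
        in finite A \<and> card A \<le> M) \<and>
     (\<exists>C. \<forall>l. diameter (supp_I (f l)) \<le> C / 2 ^ lev l) \<and>
     (\<forall>l. lev l > 0 \<longrightarrow> (\<exists>p. par p l)) \<and>
     (\<forall>p l. par p l \<longrightarrow> lev l = lev p + 1 \<and> emeasure lebesgue (supp_I (f l) \<inter> supp_I (f p)) > 0) \<and>
     (\<forall>l. N l \<in> sets lebesgue \<and> bounded (N l) \<and> supp_I (f l) \<subseteq> interior (N l)) \<and>
     (\<exists>C. \<forall>l. diameter (N l) \<le> C / 2 ^ lev l) \<and>
     (\<forall>p l. par p l \<longrightarrow> N l \<subseteq> N p)"

definition riesz_basis ::
  "'v::real_vector set \<Rightarrow> ('v \<Rightarrow> real) \<Rightarrow> ('i \<Rightarrow> 'v) \<Rightarrow> bool" where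
  "riesz_basis X nrm e \<longleftrightarrow>
     range e \<subseteq> X \<and>
     (\<forall>x\<in>X. \<forall>\<epsilon>>0. \<exists>y \<in> span (range e). nrm (x - y) < \<epsilon>) \<and>
     (\<exists>a>0. \<exists>b>0. \<forall>F c. finite F \<longrightarrow>
        a * sqrt (\<Sum>i\<in>F. (c i)\<^sup>2) \<le> nrm (\<Sum>i\<in>F. c i *\<^sub>R e i) \<and>
        nrm (\<Sum>i\<in>F. c i *\<^sub>R e i) \<le> b * sqrt (\<Sum>i\<in>F. (c i)\<^sup>2))"

definition orthonormal_basis_L2 :: "'a::euclidean_space set \<Rightarrow> ('i \<Rightarrow> 'a aefun) \<Rightarrow> bool" where
  "orthonormal_basis_L2 S e \<longleftrightarrow>
     range e \<subseteq> L2 S \<and>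
     (\<forall>i j. l2_inner (e i) (e j) = (if i = j then 1 else 0)) \<and>
     (\<forall>x \<in> L2 S. \<forall>\<epsilon>>0. \<exists>y \<in> span (range e). l2_norm (x - y) < \<epsilon>)"

abbreviation cl :: "(real \<Rightarrow> real) \<Rightarrow> real aefun" where
  "cl f \<equiv> class_on unit_I f"

abbreviation cl_deriv :: "(real \<Rightarrow> real) \<Rightarrow> real aefun" where
  "cl_deriv f \<equiv> weak_deriv unit_I 1 (class_on unit_I f)"

definition trial_wavelets ::
  "('l::countable \<Rightarrow> nat) \<Rightarrow> ('l \<Rightarrow> real \<Rightarrow> real) \<Rightarrow> ('l \<Rightarrow> 'l \<Rightarrow> bool) \<Rightarrow> ('l \<Rightarrow> real set) \<Rightarrow> bool"
where
  "trial_wavelets lev \<sigma> par N \<longleftrightarrow>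
     wavelet_collection lev \<sigma> par N \<and>
     riesz_basis (L2 unit_I) l2_norm (\<lambda>l. cl (\<sigma> l)) \<and>
     riesz_basis (H1 unit_I) (H1_norm unit_I)
       (\<lambda>l. (1 / H1_norm unit_I (cl (\<sigma> l))) *\<^sub>R cl (\<sigma> l)) \<and>
     (\<forall>l. cl (\<sigma> l) \<in> H1 unit_I) \<and>
     (\<exists>a>0. \<exists>b>0. \<forall>l. a * 2 ^ lev l \<le> H1_norm unit_I (cl (\<sigma> l)) \<and>
                        H1_norm unit_I (cl (\<sigma> l)) \<le> b * 2 ^ lev l)"

definition test_wavelets ::
  "('m::countable \<Rightarrow> nat) \<Rightarrow> ('m \<Rightarrow> real \<Rightarrow> real) \<Rightarrow> ('m \<Rightarrow> 'm \<Rightarrow> bool) \<Rightarrow> ('m \<Rightarrow> real set) \<Rightarrow> bool"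
where
  "test_wavelets lev \<psi> par N \<longleftrightarrow>
     wavelet_collection lev \<psi> par N \<and> orthonormal_basis_L2 unit_I (\<lambda>m. cl (\<psi> m))"


section \<open>Trial and test spaces\<close>

text \<open>The sum \<open>\<Sum>\<^sub>i f\<^sub>i \<otimes> U\<^sub>i\<close> as a space of functions of \<open>(t, x)\<close>.\<close>

definition tensor_space ::
  "('i \<Rightarrow> real \<Rightarrow> real) \<Rightarrow> ('i \<Rightarrow> 'a::euclidean_space aefun set) \<Rightarrow> (real \<times> 'a) aefun set" where
  "tensor_space f U = span (\<Union>i. tensor (cl (f i)) ` U i)"

definition breve ::
  "('l \<Rightarrow> nat) \<Rightarrow> ('l \<Rightarrow> real set) \<Rightarrow> ('m \<Rightarrow> nat) \<Rightarrow> ('m \<Rightarrow> real set) \<Rightarrow>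
   ('l \<Rightarrow> 'a::euclidean_space aefun set) \<Rightarrow> 'm \<Rightarrow> 'a aefun set" where
  "breve lev\<^sub>\<Sigma> N\<^sub>\<Sigma> lev\<^sub>\<Psi> N\<^sub>\<Psi> W \<mu> =
     span (\<Union>l \<in> {l. lev\<^sub>\<Sigma> l = lev\<^sub>\<Psi> \<mu> \<and> emeasure lebesgue (N\<^sub>\<Psi> \<mu> \<inter> N\<^sub>\<Sigma> l) > 0}. W l)"

text \<open>\<^const>\<open>dim\<close> is 0 by convention on infinite-dimensional spaces.\<close>

definition edim :: "'v::real_vector set \<Rightarrow> ereal" where
  "edim U = (if \<exists>B. finite B \<and> U \<subseteq> span B then ereal (real (dim U)) else \<infinity>)"

end

theory Submission
  imports Defs
begin

text \<open>
  If \<open>\<langle>\<sigma>\<^sub>\<lambda>, \<psi>\<^sub>\<mu>\<rangle>\<close> or \<open>\<langle>\<sigma>\<^sub>\<lambda>', \<psi>\<^sub>\<mu>\<rangle>\<close> is non-zero, then \<open>|\<mu>| \<le> |\<lambda>|\<close> and the supports overlap.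
  Climbing from \<open>\<lambda>\<close> to an ancestor on level \<open>|\<mu>|\<close> only enlarges the neighbourhood and the space
  \<open>W\<close>, so \<open>W\<^sub>\<lambda>\<close> is one of the spaces contained in \<open>breve W\<^sub>\<mu>\<close>; the tree condition at the test side
  follows in the same way from a single step upwards.
  For the dimensions, \<open>dim Y \<le> \<Sum>\<^sub>\<mu> dim V\<^sub>\<mu> \<lesssim> \<Sum>\<^sub>\<mu> \<Sum>\<^sub>\<lambda> dim W\<^sub>\<lambda>\<close>, where \<open>\<lambda>\<close> runs over the indices on
  level \<open>|\<mu>|\<close> with overlapping neighbourhoods. By locality each \<open>\<lambda>\<close> occurs for boundedly many
  \<open>\<mu>\<close>, and \<open>\<Sum>\<^sub>\<lambda> dim W\<^sub>\<lambda> \<le> dim X\<close> because the \<open>\<sigma>\<^sub>\<lambda>\<close> are linearly independent.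
  That \<open>\<sigma>\<^sub>\<lambda>'\<close> vanishes off the support of \<open>\<sigma>\<^sub>\<lambda>\<close> is the fundamental lemma of the calculus of
  variations, which also makes the weak derivative well defined.
\<close>

section \<open>Smooth bump functions on the line\<close>

text \<open>The class of these functions is closed under differentiation.\<close>

definition bump :: "real \<Rightarrow> real \<Rightarrow> real \<Rightarrow> nat \<Rightarrow> real poly \<Rightarrow> real \<Rightarrow> real" where
  "bump a b c k p x =
     (if a < x \<and> x < b
      then poly p x / ((x - a) * (b - x)) ^ k * exp (- (c / ((x - a) * (b - x)))) else 0)"

text \<open>A single term of the series bounds \<open>exp (c / q)\<close> from below; taking
  inverses gives the claim. Hence the exponential factor of a bump beats every power of
  \<open>q\<close> in its denominator.\<close>

lemma exp_neg_inverse_le: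
  fixes q c :: real
  assumes "q > 0" "c > 0"
  shows "exp (- (c / q)) \<le> fact n / c ^ n * q ^ n"
proof -
  have "(\<Sum>i\<in>{n}. (c / q) ^ i /\<^sub>R fact i) \<le> exp (c / q)"
    unfolding exp_def using assms
    by (intro sum_le_suminf summable_exp_generic) auto
  then have "(c / q) ^ n / fact n \<le> exp (c / q)"
    by (simp add: divide_inverse_commute)
  then have "inverse (exp (c / q)) \<le> inverse ((c / q) ^ n / fact n)"
    using assms by (intro le_imp_inverse_le) auto
  then show ?thesis
    by (simp add: exp_minus power_divide mult_ac)
qed

text \<open>The bound forces \<open>f x = 0\<close>, so the difference quotient is at most
  \<open>C * \<bar>h\<bar>\<close>. This settles differentiability at the two end points of a
  bump.\<close>

lemma has_real_derivative_zero_quadratic: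
  fixes f :: "real \<Rightarrow> real"
  assumes "\<And>y. \<bar>f y\<bar> \<le> C * (y - x)\<^sup>2"
  shows "(f has_real_derivative 0) (at x)"
proof -
  have f0: "f x = 0" using assms[of x] by simp
  have lim: "((\<lambda>h. C * \<bar>h\<bar>) \<longlongrightarrow> 0) (at 0)"
    by (auto intro!: tendsto_eq_intros)
  have le: "norm (f (x + h) / h) \<le> C * \<bar>h\<bar>" for h
  proof (cases "h = 0")
    case False
    have "\<bar>f (x + h)\<bar> / \<bar>h\<bar> \<le> C * h\<^sup>2 / \<bar>h\<bar>"
      using assms[of "x + h"] by (intro divide_right_mono) auto
    also have "C * h\<^sup>2 / \<bar>h\<bar> = C * \<bar>h\<bar>"
      using False by (simp add: power2_eq_square abs_if)
    finally show ?thesis by simp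
  qed simp
  have "((\<lambda>h. f (x + h) / h) \<longlongrightarrow> 0) (at 0)"
    by (rule Lim_null_comparison[OF always_eventually lim]) (intro allI le)
  then show ?thesis by (simp add: DERIV_def f0)
qed

text \<open>With \<open>q = (x - a) * (b - x)\<close>, the exponential estimate of order
  \<open>k + 2\<close> absorbs the denominator \<open>q ^ k\<close> and leaves
  \<open>q\<^sup>2\<close>; one factor of \<open>q\<close> is then estimated by
  \<open>b - a\<close>.\<close>

lemma bump_le_quadratic:
  assumes "c > 0"
  obtains C where "\<And>x. \<bar>bump a b c k p x\<bar> \<le> C * (x - a)\<^sup>2"
    and "\<And>x. \<bar>bump a b c k p x\<bar> \<le> C * (b - x)\<^sup>2"
proof -
  have "compact (poly p ` {a..b})"
    by (intro compact_continuous_image continuous_intros) auto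
  then obtain B where B: "B > 0" "\<And>x. x \<in> {a..b} \<Longrightarrow> \<bar>poly p x\<bar> \<le> B"
    by (auto dest!: compact_imp_bounded simp: bounded_pos)
  define D where "D = B * (fact (k + 2) / c ^ (k + 2))"
  have D: "D \<ge> 0" using B(1) assms by (simp add: D_def)
  have main: "\<bar>bump a b c k p x\<bar> \<le> D * ((x - a) * (b - x))\<^sup>2" if x: "a < x" "x < b" for x
  proof -
    define q where "q = (x - a) * (b - x)"
    have q: "q > 0" using x by (simp add: q_def)
    have "\<bar>bump a b c k p x\<bar> = \<bar>poly p x\<bar> * (exp (- (c / q)) / q ^ k)"
      using x q by (simp add: bump_def abs_mult q_def[symmetric])
    also have "\<dots> \<le> B * (fact (k + 2) / c ^ (k + 2) * q ^ (k + 2) / q ^ k)"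
      using q x B(1) assms
      by (intro mult_mono divide_right_mono exp_neg_inverse_le B) auto
    also have "\<dots> = D * q\<^sup>2" using q by (simp add: D_def power_add power2_eq_square)
    finally show ?thesis by (simp add: q_def)
  qed
  show ?thesis
  proof (rule that[of "D * (b - a)\<^sup>2"])
    fix x
    show "\<bar>bump a b c k p x\<bar> \<le> D * (b - a)\<^sup>2 * (x - a)\<^sup>2"
    proof (cases "a < x \<and> x < b")
      case True
      then have "((x - a) * (b - x))\<^sup>2 \<le> ((x - a) * (b - a))\<^sup>2"
        by (intro power_mono mult_left_mono) auto
      then have "D * ((x - a) * (b - x))\<^sup>2 \<le> D * ((x - a) * (b - a))\<^sup>2"
        by (rule mult_left_mono[OF _ D])
      with main[of x] True show ?thesis by (simp add: power_mult_distrib mult_ac)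
    next
      case False
      then have "bump a b c k p x = 0" by (auto simp: bump_def)
      then show ?thesis using D by simp
    qed
    show "\<bar>bump a b c k p x\<bar> \<le> D * (b - a)\<^sup>2 * (b - x)\<^sup>2"
    proof (cases "a < x \<and> x < b")
      case True
      then have "((x - a) * (b - x))\<^sup>2 \<le> ((b - a) * (b - x))\<^sup>2"
        by (intro power_mono mult_right_mono) auto
      then have "D * ((x - a) * (b - x))\<^sup>2 \<le> D * ((b - a) * (b - x))\<^sup>2"
        by (rule mult_left_mono[OF _ D])
      with main[of x] True show ?thesis by (simp add: power_mult_distrib mult_ac)
    next
      case False
      then have "bump a b c k p x = 0" by (auto simp: bump_def)
      then show ?thesis using D by simp
    qed
  qed
qed

text \<open>Inside the interval this is a computation; outside, the function is locally zero; at the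
  end points the quadratic bound gives derivative 0, which is also the value of every bump
  there.\<close>

lemma has_real_derivative_bump:
  assumes c: "c > 0"
  shows "\<exists>p'. \<forall>x. (bump a b c k p has_real_derivative bump a b c (k + 2) p' x) (at x)"
proof -
  define q where "q = [:-a, 1:] * [:b, -1:]"
  have q: "poly q x = (x - a) * (b - x)" for x by (simp add: q_def algebra_simps)
  \<comment> \<open>The numerator obtained by putting the three terms of the derivative over the
    common denominator \<open>q ^ (k + 2)\<close>, with the exponential factored out.\<close>
  define p' where "p' = pderiv p * q\<^sup>2 - of_nat k * (p * q * pderiv q) + smult c (p * pderiv q)"
  have "(bump a b c k p has_real_derivative bump a b c (k + 2) p' x) (at x)" for x
  proof -
    consider "a < x" "x < b" | "x = a" | "x = b" | "x < a \<or> x > b" by linarith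
    then show ?thesis
    proof cases
      case 1
      have qx: "poly q x \<noteq> 0" using 1 by (simp add: q)
      define r where "r = inverse (poly q x)"
      define e where "e = exp (- (c * r))"
      have qr: "poly q x * r = 1" using qx by (simp add: r_def)
      have "((\<lambda>x. inverse (poly q x)) has_real_derivative - (r * poly (pderiv q) x * r)) (at x)"
        unfolding r_def using qx by (auto intro!: derivative_eq_intros)
      then obtain R where R: "R = (\<lambda>x. inverse (poly q x))" "R x = r"
        "(R has_real_derivative - (r * poly (pderiv q) x * r)) (at x)"
        by (simp add: r_def)
      \<comment> \<open>This includes \<open>k = 0\<close>: the exponent \<open>k - Suc 0\<close> is
        truncated there, but the factor \<open>real k\<close> vanishes.\<close>
      have rk: "real k * r ^ (k - Suc 0) * r = real k * r ^ k" by (cases k) auto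
      have "((\<lambda>x. poly p x * R x ^ k * exp (- (c * R x))) has_real_derivative
          (poly (pderiv p) x * r ^ k - poly p x * ((real k * r ^ (k - Suc 0) * r) * r * poly (pderiv q) x)) * e
          + poly p x * r ^ k * (e * (c * poly (pderiv q) x * r\<^sup>2))) (at x)"
        by (rule derivative_eq_intros R(3) refl poly_DERIV)+
          (simp add: R(2) e_def algebra_simps power2_eq_square)
      then have "((\<lambda>x. poly p x * inverse (poly q x) ^ k * exp (- (c * inverse (poly q x)))) has_real_derivative
          (poly (pderiv p) x * r ^ k - poly p x * (of_nat k * (r ^ Suc k * poly (pderiv q) x))) * e
          + poly p x * r ^ k * (e * (c * poly (pderiv q) x * r\<^sup>2))) (at x)"
        unfolding rk R(1) by (simp add: mult_ac)
      moreover have "(poly (pderiv p) x * r ^ k - poly p x * (of_nat k * (r ^ Suc k * poly (pderiv q) x))) * e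
          + poly p x * r ^ k * (e * (c * poly (pderiv q) x * r\<^sup>2)) = bump a b c (k + 2) p' x"
      proof -
        have "poly p' x * r\<^sup>2 = poly (pderiv p) x * (poly q x * r)\<^sup>2
            - of_nat k * poly p x * (poly q x * r) * poly (pderiv q) x * r + c * poly p x * poly (pderiv q) x * r\<^sup>2"
          by (simp add: p'_def algebra_simps power2_eq_square)
        then have *: "poly p' x * r\<^sup>2 = poly (pderiv p) x
            - of_nat k * poly p x * poly (pderiv q) x * r + c * poly p x * poly (pderiv q) x * r\<^sup>2"
          by (simp add: qr)
        have "bump a b c (k + 2) p' x = (poly p' x * r\<^sup>2) * r ^ k * e"
        proof -
          have "bump a b c (k + 2) p' x = poly p' x / poly q x ^ (k + 2) * exp (- (c / poly q x))"
            using 1 by (simp only: bump_def q simp_thms if_True)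
          then show ?thesis by (simp add: r_def e_def divide_inverse power_inverse power_add power2_eq_square mult_ac)
        qed
        then show ?thesis unfolding * by (simp add: algebra_simps)
      qed
      moreover have "\<forall>\<^sub>F y in nhds x. bump a b c k p y = poly p y * inverse (poly q y) ^ k * exp (- (c * inverse (poly q y)))"
      proof -
        have "\<forall>\<^sub>F y in nhds x. y \<in> {a<..<b}"
          using 1 by (intro eventually_nhds_in_open) auto
        then show ?thesis by eventually_elim (simp add: bump_def q divide_inverse power_inverse power_mult_distrib)
      qed
      ultimately show ?thesis by (simp add: DERIV_cong_ev[OF refl _ refl])
    next
      case 2
      obtain C where "\<And>y. \<bar>bump a b c k p y\<bar> \<le> C * (y - a)\<^sup>2"
        using bump_le_quadratic[OF c] by blast
      then have "(bump a b c k p has_real_derivative 0) (at x)"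
        using 2 by (intro has_real_derivative_zero_quadratic[of _ C]) simp
      moreover have "bump a b c (k + 2) p' x = 0" using 2 by (simp add: bump_def)
      ultimately show ?thesis by (simp only:)
    next
      case 3
      obtain C where "\<And>y. \<bar>bump a b c k p y\<bar> \<le> C * (b - y)\<^sup>2"
        using bump_le_quadratic[OF c] by blast
      then have "(bump a b c k p has_real_derivative 0) (at x)"
        using 3 by (intro has_real_derivative_zero_quadratic[of _ C]) (metis power2_commute)
      moreover have "bump a b c (k + 2) p' x = 0" using 3 by (simp add: bump_def)
      ultimately show ?thesis by (simp only:)
    next
      case 4
      have "\<forall>\<^sub>F y in nhds x. bump a b c k p y = 0"
      proof -
        have "\<forall>\<^sub>F y in nhds x. y \<in> {..<a} \<union> {b<..}"
          using 4 by (intro eventually_nhds_in_open) auto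
        then show ?thesis by eventually_elim (auto simp add: bump_def)
      qed
      moreover have "bump a b c (k + 2) p' x = 0" using 4 by (auto simp: bump_def)
      ultimately show ?thesis by (subst DERIV_cong_ev[OF refl _ refl]) auto
    qed
  qed
  then show ?thesis by (intro exI[of _ p'] allI)
qed

lemma partial_deriv_eq:
  assumes "(f has_real_derivative d) (at x)"
  shows "partial_deriv 1 f x = d"
proof -
  have "(f has_derivative (*) d) (at x)" using assms by (simp add: has_field_derivative_def)
  from frechet_derivative_at[OF this, symmetric] show ?thesis by (simp add: partial_deriv_def)
qed

text \<open>As 1 is the only basis vector of the line, every iterated partial derivative is again a
  bump, so smoothness reduces to differentiability of all bumps.\<close>

lemma test_function_bump:
  assumes c: "c > 0" and ab: "{a..b} \<subseteq> S"
  shows "test_function S (bump a b c k p)"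
proof -
  have ex: "\<exists>k' p'. foldr partial_deriv bs (bump a b c k p) = bump a b c k' p'"
    if "bs \<in> lists Basis" for bs
    using that
  proof (induction bs)
    case (Cons x xs)
    then obtain k' p' where *: "foldr partial_deriv xs (bump a b c k p) = bump a b c k' p'" by auto
    obtain p'' where "\<And>x. (bump a b c k' p' has_real_derivative bump a b c (k' + 2) p'' x) (at x)"
      using has_real_derivative_bump[OF c] by blast
    then have "partial_deriv 1 (bump a b c k' p') = bump a b c (k' + 2) p''"
      by (intro ext partial_deriv_eq)
    moreover have "x = 1" using Cons.hyps by simp
    ultimately show ?case using * by auto
  qed auto
  have diff: "bump a b c k' p' differentiable_on UNIV" for k' p'
    using has_real_derivative_bump[OF c, of a b k' p']
    by (fastforce simp: differentiable_on_def real_differentiable_def)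
  have "smooth_on UNIV (bump a b c k p)"
    unfolding smooth_on_def
  proof (intro ballI)
    fix bs :: "real list" assume "bs \<in> lists Basis"
    then obtain k' p' where "foldr partial_deriv bs (bump a b c k p) = bump a b c k' p'"
      using ex by blast
    then show "foldr partial_deriv bs (bump a b c k p) differentiable_on UNIV"
      using diff by (simp only:)
  qed
  moreover have "compact {a..b} \<and> {a..b} \<subseteq> S \<and> (\<forall>x. x \<notin> {a..b} \<longrightarrow> bump a b c k p x = 0)"
    using ab by (auto simp: bump_def)
  ultimately show ?thesis unfolding test_function_def by blast
qed

section \<open>The fundamental lemma of the calculus of variations\<close>

text \<open>The sets over which the integral vanishes are closed under complements (by
  \<open>total\<close>) and countable disjoint unions, so induction from the intersection-stable
  open intervals reaches all Borel sets.\<close>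

lemma set_integral_eq_0_lebesgueI:
  fixes h :: "real \<Rightarrow> real"
  assumes h: "integrable lebesgue h" and total: "(LINT x|lebesgue. h x) = 0"
    and box: "\<And>l u. (LINT x:{l<..<u}|lebesgue. h x) = 0"
    and A: "A \<in> sets lebesgue"
  shows "(LINT x:A|lebesgue. h x) = 0"
proof -
  have int: "set_integrable lebesgue S h" if "S \<in> sets lebesgue" for S
    using integrable_mult_indicator[OF that h] by (simp add: set_integrable_def)
  let ?E = "range (\<lambda>(l, u). box l u :: real set)"
  have E: "Int_stable ?E"
    by (auto simp: Int_stable_def box_Int_box)
  have E_Pow: "?E \<subseteq> Pow UNIV" by simp
  have sets: "S \<in> sigma_sets UNIV ?E \<longleftrightarrow> S \<in> sets borel" for S
    by (subst borel_eq_box) simp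
  have borel: "(LINT x:S|lebesgue. h x) = 0" if "S \<in> sets borel" for S
    using E E_Pow that[folded sets]
  proof (induction rule: sigma_sets_induct_disjoint)
    case (basic S)
    then show ?case using box by auto
  next
    case empty
    show ?case by (simp add: set_lebesgue_integral_def)
  next
    case (compl S)
    from compl.hyps have S: "S \<in> sets lebesgue" by (simp add: sets)
    have "(LINT x|lebesgue. h x) = (LINT x:S \<union> (UNIV - S)|lebesgue. h x)"
      by (simp add: set_lebesgue_integral_def)
    also have "\<dots> = (LINT x:S|lebesgue. h x) + (LINT x:UNIV - S|lebesgue. h x)"
      using S sets.compl_sets[OF S] by (intro set_integral_Un int) (auto simp: Compl_eq_Diff_UNIV)
    finally show ?case using compl.IH total by simp
  next
    case (union S)
    have S: "S i \<in> sets lebesgue" for i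
    proof -
      have "S i \<in> sets borel" using union.hyps(2) sets by blast
      then show ?thesis by simp
    qed
    have "(LINT x:(\<Union>i. S i)|lebesgue. h x) = (\<Sum>i. LINT x:S i|lebesgue. h x)"
      using union.hyps(1) S by (intro lebesgue_integral_countable_add int)
        (auto simp: disjoint_family_on_def)
    then show ?case using union.IH by simp
  qed
  \<comment> \<open>A Lebesgue set differs from a Borel set \<open>S\<close> only within a null set
    \<open>N'\<close>, which leaves the integral unchanged.\<close>
  obtain S N N' where *: "A = S \<union> N" "N \<subseteq> N'" "N' \<in> null_sets lborel" "S \<in> sets lborel"
    using A by (rule sets_completionE)
  have "AE x in lebesgue. x \<notin> N'"
    using *(3) by (intro AE_not_in) (simp add: null_sets_completionI)
  then have "AE x in lebesgue. indicator A x *\<^sub>R h x = indicator S x *\<^sub>R h x"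
    by eventually_elim (use * in \<open>auto simp: indicator_def\<close>)
  moreover have "(\<lambda>x. indicator S x *\<^sub>R h x) \<in> borel_measurable lebesgue"
    "(\<lambda>x. indicator A x *\<^sub>R h x) \<in> borel_measurable lebesgue"
    using int[of A] int[of S] A *(4) by (auto simp: set_integrable_def)
  ultimately have "(LINT x:A|lebesgue. h x) = (LINT x:S|lebesgue. h x)"
    unfolding set_lebesgue_integral_def by (intro integral_cong_AE)
  with borel[of S] *(4) show ?thesis by simp
qed

lemma test_function_continuous:
  assumes "test_function S \<phi>"
  shows "continuous_on UNIV \<phi>"
proof -
  have "foldr partial_deriv [] \<phi> differentiable_on UNIV"
    using assms unfolding test_function_def smooth_on_def by blast
  then show ?thesis by (auto intro: differentiable_imp_continuous_on)
qed

text \<open>Completion preserves the measure of Borel sets, so a countable cover for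
  \<open>lborel\<close> still serves. This is what allows \<open>density_zero\<close> to be applied
  to \<open>lebesgue\<close>.\<close>

lemma sigma_finite_lebesgue: "sigma_finite_measure (lebesgue :: 'a::euclidean_space measure)"
proof
  obtain A where "countable A" "A \<subseteq> sets (lborel :: 'a measure)" "\<Union>A = space (lborel :: 'a measure)"
    "\<forall>a\<in>A. emeasure (lborel :: 'a measure) a \<noteq> \<infinity>"
    using lborel.sigma_finite_countable by blast
  then show "\<exists>A. countable A \<and> A \<subseteq> sets lebesgue \<and> \<Union>A = space (lebesgue :: 'a measure) \<and>
      (\<forall>a\<in>A. emeasure (lebesgue :: 'a measure) a \<noteq> \<infinity>)"
    by (intro exI[of _ A]) (auto simp: subset_eq)
qed

text \<open>Dominated convergence along bumps, with majorant \<open>\<bar>g x\<bar>\<close>, yields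
  vanishing integrals over open intervals. Cutting \<open>g\<close> off outside
  \<open>{c<..<d}\<close> then gives vanishing integrals over all measurable sets.\<close>

lemma AE_eq_0_on_Icc:
  fixes g :: "real \<Rightarrow> real"
  assumes g: "integrable lebesgue g"
    and S: "{c..d} \<subseteq> S"
    and 0: "\<And>\<phi>. test_function S \<phi> \<Longrightarrow> (LINT x|lebesgue. g x * \<phi> x) = 0"
  shows "AE x in lebesgue. x \<in> {c<..<d} \<longrightarrow> g x = 0"
proof -
  have Ioo: "(LINT x:{a<..<b}|lebesgue. g x) = 0" if ab: "{a..b} \<subseteq> S" for a b
  proof -
    \<comment> \<open>the \<open>(n + 1)\<close>-th roots of a fixed bump increase to the indicator of the interval\<close>
    define \<phi> where "\<phi> n = bump a b (1 / real (Suc n)) 0 1" for n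
    have test: "test_function S (\<phi> n)" for n
      unfolding \<phi>_def using ab by (intro test_function_bump) auto
    have \<phi>: "\<phi> n x = (if a < x \<and> x < b then exp (- (1 / real (Suc n) / ((x - a) * (b - x)))) else 0)" for n x
      by (simp add: \<phi>_def bump_def)
    have "(\<lambda>n. LINT x|lebesgue. g x * \<phi> n x) \<longlonglongrightarrow> (LINT x|lebesgue. indicator {a<..<b} x *\<^sub>R g x)"
    proof (rule integral_dominated_convergence[where w = "\<lambda>x. \<bar>g x\<bar>"])
      show "(\<lambda>x. indicator {a<..<b} x *\<^sub>R g x) \<in> borel_measurable lebesgue"
        by (intro borel_measurable_integrable integrable_mult_indicator g) auto
      show "(\<lambda>x. g x * \<phi> n x) \<in> borel_measurable lebesgue" for n
        using g continuous_imp_measurable_on_sets_lebesgue[OF test_function_continuous[OF test[of n]]]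
        by auto
      show "integrable lebesgue (\<lambda>x. \<bar>g x\<bar>)" using g by auto
      show "AE x in lebesgue. (\<lambda>n. g x * \<phi> n x) \<longlonglongrightarrow> indicator {a<..<b} x *\<^sub>R g x"
      proof (rule AE_I2)
        fix x
        show "(\<lambda>n. g x * \<phi> n x) \<longlonglongrightarrow> indicator {a<..<b} x *\<^sub>R g x"
        proof (cases "a < x \<and> x < b")
          case True
          have "(\<lambda>n. 1 / real (Suc n)) \<longlonglongrightarrow> 0"
            using LIMSEQ_Suc[OF lim_1_over_n] by simp
          then have "(\<lambda>n. g x * exp (- (1 / real (Suc n) / ((x - a) * (b - x)))))
              \<longlonglongrightarrow> g x * exp (- (0 / ((x - a) * (b - x))))"
            using True by (intro tendsto_intros) auto
          then show ?thesis using True by (simp add: \<phi>)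
        qed (auto simp: \<phi>)
      qed
      show "AE x in lebesgue. norm (g x * \<phi> n x) \<le> \<bar>g x\<bar>" for n
      proof (rule AE_I2)
        fix x
        have "\<bar>\<phi> n x\<bar> \<le> 1" by (simp add: \<phi>)
        from mult_left_mono[OF this, of "\<bar>g x\<bar>"] show "norm (g x * \<phi> n x) \<le> \<bar>g x\<bar>"
          by (simp add: abs_mult)
      qed
    qed
    then show ?thesis
      using 0[OF test] by (simp add: set_lebesgue_integral_def LIMSEQ_const_iff)
  qed
  define h where "h x = indicator {c<..<d} x *\<^sub>R g x" for x
  have h: "integrable lebesgue h"
    unfolding h_def by (intro integrable_mult_indicator g) auto
  have "AE x in lebesgue. h x = 0"
  proof (rule sigma_finite_measure.density_zero[OF sigma_finite_lebesgue h], rule set_integral_eq_0_lebesgueI[OF h])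
    show "(LINT x|lebesgue. h x) = 0"
      using Ioo[OF S] by (simp add: h_def set_lebesgue_integral_def)
    show "(LINT x:{l<..<u}|lebesgue. h x) = 0" for l u
    proof -
      \<comment> \<open>The cut-off merges two intervals into one whose closed version lies in
        \<open>{c..d}\<close>, so that \<open>Ioo\<close> applies.\<close>
      have "(LINT x:{l<..<u}|lebesgue. h x) = (LINT x:{max l c<..<min u d}|lebesgue. g x)"
        unfolding set_lebesgue_integral_def h_def
        by (intro Bochner_Integration.integral_cong) (auto simp: indicator_def)
      also have "\<dots> = 0" using S by (intro Ioo) auto
      finally show ?thesis .
    qed
  qed
  then show ?thesis by eventually_elim (simp add: h_def indicator_def)
qed

text \<open>An open set is a countable union of open intervals with rational end points whose closed
  versions lie in it, and countably many null sets have a null union.\<close>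

lemma AE_eq_0_on_open:
  fixes g :: "real \<Rightarrow> real"
  assumes g: "integrable lebesgue g" and S: "open S"
    and 0: "\<And>\<phi>. test_function S \<phi> \<Longrightarrow> (LINT x|lebesgue. g x * \<phi> x) = 0"
  shows "AE x in lebesgue. x \<in> S \<longrightarrow> g x = 0"
proof -
  define J where "J = {(c, d). c \<in> \<rat> \<and> d \<in> \<rat> \<and> {c..d} \<subseteq> S}"
  have "countable J"
    by (rule countable_subset[of _ "\<rat> \<times> \<rat>"]) (auto simp: J_def countable_rat)
  moreover have "\<forall>p\<in>J. AE x in lebesgue. x \<in> {fst p<..<snd p} \<longrightarrow> g x = 0"
    using AE_eq_0_on_Icc[OF g _ 0] by (auto simp: J_def)
  ultimately have "AE x in lebesgue. \<forall>p\<in>J. x \<in> {fst p<..<snd p} \<longrightarrow> g x = 0"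
    by (simp only: AE_ball_countable)
  then show ?thesis
  proof eventually_elim
    case (elim x)
    show ?case
    proof
      assume "x \<in> S"
      then obtain e where e: "e > 0" "cball x e \<subseteq> S"
        using S open_contains_cball by blast
      obtain c d where "c \<in> \<rat>" "x - e < c" "c < x" "d \<in> \<rat>" "x < d" "d < x + e"
        using Rats_dense_in_real[of "x - e" x] Rats_dense_in_real[of x "x + e"] e by auto
      moreover from this have "{c..d} \<subseteq> cball x e" by (auto simp: dist_real_def)
      ultimately have "(c, d) \<in> J" using e by (auto simp: J_def)
      with elim \<open>c < x\<close> \<open>x < d\<close> show "g x = 0" by force
    qed
  qed
qed

section \<open>Square integrable functions and weak derivatives\<close>

lemma l2_inner_abs_aefun: "l2_inner (abs_aefun f) (abs_aefun g) = (LINT x|lebesgue. f x * g x)"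
  by (rule l2_inner.abs_eq)

text \<open>Extension by zero provides a representative on the whole space, so later integrals run
  over \<open>lebesgue\<close> instead of \<open>lebesgue_on S\<close>.\<close>

lemma in_L2E:
  assumes u: "u \<in> L2 S" and S: "S \<in> sets lebesgue"
  obtains f where "u = abs_aefun f" "f \<in> borel_measurable lebesgue"
    "integrable lebesgue (\<lambda>x. (f x)\<^sup>2)" "\<And>x. x \<notin> S \<Longrightarrow> f x = 0"
proof -
  obtain g where g: "u = class_on S g" "g \<in> borel_measurable (lebesgue_on S)"
    "integrable (lebesgue_on S) (\<lambda>x. (g x)\<^sup>2)"
    using u by (auto simp: L2_def)
  define f where "f x = (if x \<in> S then g x else 0)" for x
  have f: "f = (\<lambda>x. indicator S x *\<^sub>R g x)" by (auto simp: f_def indicator_def)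
  show ?thesis
  proof (rule that[of f])
    show "u = abs_aefun f" by (simp add: g(1) class_on_def f_def[abs_def])
    show "f \<in> borel_measurable lebesgue"
      using g(2) S unfolding f by (subst (asm) borel_measurable_restrict_space_iff) auto
    have "integrable lebesgue (\<lambda>x. indicator S x *\<^sub>R (g x)\<^sup>2)"
      using g(3) S by (subst (asm) integrable_restrict_space) auto
    then show "integrable lebesgue (\<lambda>x. (f x)\<^sup>2)"
      by (rule back_subst[of "integrable lebesgue"]) (auto simp: f_def indicator_def)
  qed (simp add: f_def)
qed

lemma in_L2I:
  assumes S: "S \<in> sets lebesgue" and f: "f \<in> borel_measurable lebesgue"
    "integrable lebesgue (\<lambda>x. (f x)\<^sup>2)" "\<And>x. x \<notin> S \<Longrightarrow> f x = 0"
  shows "abs_aefun f \<in> L2 S"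
proof -
  have "class_on S f = abs_aefun f"
    unfolding class_on_def using f(3) by (intro arg_cong[of _ _ abs_aefun]) auto
  moreover have "f \<in> borel_measurable (lebesgue_on S)"
    using f(1) by (rule measurable_restrict_space1)
  moreover have "integrable (lebesgue_on S) (\<lambda>x. (f x)\<^sup>2)"
  proof -
    have "(\<lambda>x. indicator S x *\<^sub>R (f x)\<^sup>2) = (\<lambda>x. (f x)\<^sup>2)"
      using f(3) by (auto simp: fun_eq_iff indicator_def of_bool_def)
    then show ?thesis using f(2) S by (subst integrable_restrict_space) auto
  qed
  ultimately show ?thesis
    unfolding L2_def by (intro CollectI exI[of _ f] conjI) (simp_all only:)
qed

lemma integrable_mult_square_integrable:
  fixes f g :: "'a \<Rightarrow> real"
  assumes "f \<in> borel_measurable M" "integrable M (\<lambda>x. (f x)\<^sup>2)"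
    and "g \<in> borel_measurable M" "integrable M (\<lambda>x. (g x)\<^sup>2)"
  shows "integrable M (\<lambda>x. f x * g x)"
proof (rule Bochner_Integration.integrable_bound[of _ "\<lambda>x. (f x)\<^sup>2 + (g x)\<^sup>2"])
  show "integrable M (\<lambda>x. (f x)\<^sup>2 + (g x)\<^sup>2)" using assms by simp
  show "(\<lambda>x. f x * g x) \<in> borel_measurable M" using assms by simp
  show "AE x in M. norm (f x * g x) \<le> norm ((f x)\<^sup>2 + (g x)\<^sup>2)"
  proof (rule AE_I2)
    fix x
    have "2 * (\<bar>f x\<bar> * \<bar>g x\<bar>) \<le> (f x)\<^sup>2 + (g x)\<^sup>2"
      using sum_squares_bound[of "\<bar>f x\<bar>" "\<bar>g x\<bar>"] by simp
    moreover have "0 \<le> \<bar>f x\<bar> * \<bar>g x\<bar>" by simp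
    ultimately have "\<bar>f x\<bar> * \<bar>g x\<bar> \<le> (f x)\<^sup>2 + (g x)\<^sup>2" by linarith
    then show "norm (f x * g x) \<le> norm ((f x)\<^sup>2 + (g x)\<^sup>2)" by (simp add: abs_mult)
  qed
qed

text \<open>Membership in \<open>L2 S\<close> makes products integrable. This matters because
  \<open>l2_inner\<close> is defined for all classes and takes the default value 0 on non-integrable
  products, where additivity may fail.\<close>

lemma
  assumes u: "u \<in> L2 S" and v: "v \<in> L2 S" and S: "S \<in> sets lebesgue"
  shows L2_add: "u + v \<in> L2 S"
    and l2_inner_add_left: "w \<in> L2 S \<Longrightarrow> l2_inner (u + v) w = l2_inner u w + l2_inner v w"
proof -
  obtain f where f: "u = abs_aefun f" "f \<in> borel_measurable lebesgue"
    "integrable lebesgue (\<lambda>x. (f x)\<^sup>2)" "\<And>x. x \<notin> S \<Longrightarrow> f x = 0"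
    using in_L2E[OF u S] by blast
  obtain g where g: "v = abs_aefun g" "g \<in> borel_measurable lebesgue"
    "integrable lebesgue (\<lambda>x. (g x)\<^sup>2)" "\<And>x. x \<notin> S \<Longrightarrow> g x = 0"
    using in_L2E[OF v S] by blast
  have uv: "u + v = abs_aefun (\<lambda>x. f x + g x)"
    by (simp add: f(1) g(1) plus_aefun.abs_eq)
  have "(\<lambda>x. (f x + g x)\<^sup>2) = (\<lambda>x. (f x)\<^sup>2 + (g x)\<^sup>2 + 2 * (f x * g x))"
    by (simp add: power2_sum algebra_simps)
  then have "integrable lebesgue (\<lambda>x. (f x + g x)\<^sup>2)"
    using integrable_mult_square_integrable[OF f(2,3) g(2,3)] f(3) g(3) by simp
  then show "u + v \<in> L2 S"
    unfolding uv using f g S by (intro in_L2I) auto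
  assume w: "w \<in> L2 S"
  obtain h where h: "w = abs_aefun h" "h \<in> borel_measurable lebesgue"
    "integrable lebesgue (\<lambda>x. (h x)\<^sup>2)"
    using in_L2E[OF w S] by blast
  show "l2_inner (u + v) w = l2_inner u w + l2_inner v w"
    using integrable_mult_square_integrable[OF f(2,3) h(2,3)]
      integrable_mult_square_integrable[OF g(2,3) h(2,3)]
    unfolding uv unfolding f(1) g(1) h(1) l2_inner_abs_aefun by (simp add: distrib_right)
qed

text \<open>Holds without integrability: either \<open>c = 0\<close>, or both integrals take the
  default value 0.\<close>

lemma l2_inner_scaleR_left: "l2_inner (c *\<^sub>R u) w = c * l2_inner u w"
  by transfer (simp add: mult.assoc)

lemma L2_scaleR:
  assumes u: "u \<in> L2 S" and S: "S \<in> sets lebesgue"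
  shows "c *\<^sub>R u \<in> L2 S"
proof -
  obtain f where f: "u = abs_aefun f" "f \<in> borel_measurable lebesgue"
    "integrable lebesgue (\<lambda>x. (f x)\<^sup>2)" "\<And>x. x \<notin> S \<Longrightarrow> f x = 0"
    using in_L2E[OF u S] by blast
  have "abs_aefun (\<lambda>x. c * f x) \<in> L2 S"
    using f S by (intro in_L2I) (auto simp: power_mult_distrib)
  then show ?thesis by (simp add: f(1) scaleR_aefun.abs_eq)
qed

lemma subspace_l2_orthogonal:
  assumes w: "w \<in> L2 S" and S: "S \<in> sets lebesgue"
  shows "subspace {u \<in> L2 S. l2_inner u w = 0}"
proof -
  have "0 \<in> L2 S"
    unfolding zero_aefun_def using S by (intro in_L2I) auto
  moreover have "l2_inner 0 w = 0"
    using l2_inner_scaleR_left[of 0 0 w] by simp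
  ultimately show ?thesis
    using l2_inner_add_left[OF _ _ S w] L2_add[OF _ _ S] L2_scaleR[OF _ S]
    by (auto simp: subspace_def l2_inner_scaleR_left)
qed

lemma class_on_test_function_L2:
  assumes \<phi>: "test_function S \<phi>" and S: "S \<in> sets lebesgue"
  shows "class_on S \<phi> \<in> L2 S"
proof -
  obtain K where K: "compact K" "K \<subseteq> S" "\<And>x. x \<notin> K \<Longrightarrow> \<phi> x = 0"
    using \<phi> by (auto simp: test_function_def)
  note cont = test_function_continuous[OF \<phi>]
  have "integrable lborel (\<lambda>x. indicator K x *\<^sub>R (\<phi> x)\<^sup>2)"
    using K(1) by (intro borel_integrable_compact continuous_intros continuous_on_subset[OF cont]) auto
  moreover have "(\<lambda>x. indicator K x *\<^sub>R (\<phi> x)\<^sup>2) = (\<lambda>x. (\<phi> x)\<^sup>2)"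
    using K(3) by (auto simp: fun_eq_iff indicator_def of_bool_def)
  ultimately have "integrable lborel (\<lambda>x. (\<phi> x)\<^sup>2)" by simp
  then have "integrable lebesgue (\<lambda>x. (\<phi> x)\<^sup>2)"
    using integrable_completion[of "\<lambda>x. (\<phi> x)\<^sup>2" lborel] by auto
  moreover have "\<phi> \<in> borel_measurable lebesgue"
    using continuous_imp_measurable_on_sets_lebesgue[OF cont] by simp
  moreover have "class_on S \<phi> = abs_aefun \<phi>"
    unfolding class_on_def using K(2,3) by (intro arg_cong[of _ _ abs_aefun]) (auto simp: fun_eq_iff)
  ultimately show ?thesis using K S by (auto intro!: in_L2I)
qed

text \<open>On a bounded \<open>S\<close> the indicator is square integrable, so the given
  \<open>L2\<close> function is integrable and the fundamental lemma applies. The subset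
  \<open>S'\<close> is all of \<open>S\<close> for uniqueness of weak derivatives, and the part of
  \<open>S\<close> off a support for their locality.\<close>

lemma l2_orthogonal_test_functions_AE:
  fixes S :: "real set"
  assumes S: "S \<in> sets lebesgue" "bounded S" and S': "open S'" "S' \<subseteq> S"
    and f: "abs_aefun f \<in> L2 S"
    and 0: "\<And>\<phi>. test_function S' \<phi> \<Longrightarrow> l2_inner (abs_aefun f) (class_on S \<phi>) = 0"
  shows "AE x in lebesgue. x \<in> S' \<longrightarrow> f x = 0"
proof -
  obtain g where g: "abs_aefun f = abs_aefun g" "g \<in> borel_measurable lebesgue"
    "integrable lebesgue (\<lambda>x. (g x)\<^sup>2)" "\<And>x. x \<notin> S \<Longrightarrow> g x = 0"
    using in_L2E[OF f S(1)] by blast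
  have "S \<in> lmeasurable" using S by (simp add: bounded_set_imp_lmeasurable)
  then have "S \<in> sets lebesgue" "emeasure lebesgue S < \<infinity>"
    unfolding fmeasurable_def by blast+
  then have "integrable lebesgue (indicator S :: real \<Rightarrow> real)"
    by (rule integrable_real_indicator)
  moreover have "(\<lambda>x. (indicator S x)\<^sup>2) = (indicator S :: real \<Rightarrow> real)"
    by (auto simp: fun_eq_iff indicator_def)
  ultimately have "integrable lebesgue (\<lambda>x. g x * indicator S x)"
    using g S by (intro integrable_mult_square_integrable) simp_all
  moreover have "(\<lambda>x. g x * indicator S x) = g"
    using g(4) by (auto simp: fun_eq_iff indicator_def of_bool_def)
  ultimately have "integrable lebesgue g" by simp
  then have "AE x in lebesgue. x \<in> S' \<longrightarrow> g x = 0"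
  proof (rule AE_eq_0_on_open[OF _ S'(1)])
    fix \<phi> assume \<phi>: "test_function S' \<phi>"
    then have "\<phi> x = 0" if "x \<notin> S" for x
      using that S' by (auto simp: test_function_def)
    then have "class_on S \<phi> = abs_aefun \<phi>"
      unfolding class_on_def by (intro arg_cong[of _ _ abs_aefun]) (auto simp: fun_eq_iff)
    with 0[OF \<phi>] show "(LINT x|lebesgue. g x * \<phi> x) = 0"
      by (simp add: g(1) l2_inner_abs_aefun)
  qed
  moreover have "AE x in lebesgue. f x = g x"
    using g(1) by (simp add: aefun.abs_eq_iff ae_eq_def)
  ultimately show ?thesis by eventually_elim auto
qed

lemma is_weak_deriv_unique:
  fixes S :: "real set"
  assumes S: "open S" "bounded S" and g: "g \<in> L2 S" "is_weak_deriv S b u g"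
    and h: "h \<in> L2 S" "is_weak_deriv S b u h"
  shows "g = h"
proof -
  have S': "S \<in> sets lebesgue" using S by simp
  have gh: "g + (- 1) *\<^sub>R h \<in> L2 S"
    using g h S' by (intro L2_add L2_scaleR)
  then obtain f where f: "g + (- 1) *\<^sub>R h = abs_aefun f" "\<And>x. x \<notin> S \<Longrightarrow> f x = 0"
    using in_L2E[OF _ S'] by blast
  have "AE x in lebesgue. x \<in> S \<longrightarrow> f x = 0"
  proof (rule l2_orthogonal_test_functions_AE[OF S' S(2) S(1) order_refl])
    show "abs_aefun f \<in> L2 S" using gh f by simp
    fix \<phi> assume \<phi>: "test_function S \<phi>"
    have "l2_inner u (class_on S (partial_deriv b \<phi>)) = - l2_inner g (class_on S \<phi>)"
      "l2_inner u (class_on S (partial_deriv b \<phi>)) = - l2_inner h (class_on S \<phi>)"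
      using g(2) h(2) \<phi> unfolding is_weak_deriv_def by blast+
    then have "l2_inner g (class_on S \<phi>) = l2_inner h (class_on S \<phi>)" by simp
    moreover have "l2_inner (abs_aefun f) (class_on S \<phi>) =
        l2_inner g (class_on S \<phi>) + (- 1) * l2_inner h (class_on S \<phi>)"
      unfolding f(1)[symmetric] l2_inner_scaleR_left[symmetric]
      by (intro l2_inner_add_left[OF g(1) L2_scaleR[OF h(1) S'] S'] class_on_test_function_L2 \<phi> S')
    ultimately show "l2_inner (abs_aefun f) (class_on S \<phi>) = 0" by simp
  qed
  then have "AE x in lebesgue. f x = 0"
    by eventually_elim (use f(2) in auto)
  then have "abs_aefun f = 0" by (simp add: zero_aefun_def aefun.abs_eq_iff ae_eq_def)
  then show ?thesis using f(1) by simp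
qed

text \<open>Existence comes from \<open>H1\<close> and uniqueness from
  \<open>is_weak_deriv_unique\<close>, so the definite description in \<open>weak_deriv\<close>
  denotes.\<close>

lemma weak_deriv_props:
  fixes S :: "real set"
  assumes S: "open S" "bounded S" and u: "u \<in> H1 S"
  shows "weak_deriv S 1 u \<in> L2 S \<and> is_weak_deriv S 1 u (weak_deriv S 1 u)"
proof -
  have "\<exists>g\<in>L2 S. is_weak_deriv S 1 u g" using u by (simp add: H1_def)
  then have "\<exists>!g. g \<in> L2 S \<and> is_weak_deriv S 1 u g"
    using is_weak_deriv_unique[OF S] by blast
  then show ?thesis unfolding weak_deriv_def by (rule theI')
qed

lemma partial_deriv_eq_0_outside:
  assumes \<phi>: "test_function S \<phi>" and x: "x \<notin> S"
  shows "partial_deriv b \<phi> x = 0"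
proof -
  obtain K where K: "compact K" "K \<subseteq> S" "\<forall>x. x \<notin> K \<longrightarrow> \<phi> x = 0"
    using \<phi> unfolding test_function_def by blast
  have "open (- K)" using K(1) by (simp add: compact_imp_closed open_Compl)
  moreover have "x \<in> - K" using K(2) x by blast
  ultimately have "(\<phi> has_derivative (\<lambda>_. 0)) (at x)"
    by (rule has_derivative_transform_within_open[OF has_derivative_const]) (use K(3) in simp)
  from frechet_derivative_at[OF this, symmetric] show ?thesis by (simp add: partial_deriv_def)
qed

text \<open>Locality: if a test function lives off the closure of
  \<open>{x \<in> S. f x \<noteq> 0}\<close>, the product of \<open>f\<close> with its derivative is
  zero, so the weak derivative is orthogonal to it. For \<open>S = unit_I\<close> the exceptional
  set is \<open>supp_I f\<close>.\<close>

lemma weak_deriv_AE_0: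
  fixes S :: "real set"
  assumes S: "open S" "bounded S" and f: "class_on S f \<in> H1 S"
  obtains g where "weak_deriv S 1 (class_on S f) = abs_aefun g"
    "AE x in lebesgue. x \<notin> S \<inter> closure {x \<in> S. f x \<noteq> 0} \<longrightarrow> g x = 0"
proof -
  let ?S' = "S - closure {x \<in> S. f x \<noteq> 0}"
  have S': "S \<in> sets lebesgue" using S by simp
  have w: "weak_deriv S 1 (class_on S f) \<in> L2 S"
    "is_weak_deriv S 1 (class_on S f) (weak_deriv S 1 (class_on S f))"
    using weak_deriv_props[OF S f] by auto
  obtain g where g: "weak_deriv S 1 (class_on S f) = abs_aefun g" "\<And>x. x \<notin> S \<Longrightarrow> g x = 0"
    using in_L2E[OF w(1) S'] by blast
  have "AE x in lebesgue. x \<in> ?S' \<longrightarrow> g x = 0"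
  proof (rule l2_orthogonal_test_functions_AE[OF S' S(2)])
    show "open ?S'" "?S' \<subseteq> S" using S(1) by auto
    show "abs_aefun g \<in> L2 S" using w(1) g(1) by simp
    fix \<phi> assume \<phi>: "test_function ?S' \<phi>"
    then have \<phi>': "test_function S \<phi>" unfolding test_function_def by blast
    \<comment> \<open>Off \<open>?S'\<close> the derivative of \<open>\<phi>\<close> vanishes; on
      \<open>?S'\<close> it is \<open>f\<close> that vanishes.\<close>
    have "(if x \<in> S then f x else 0) * (if x \<in> S then partial_deriv 1 \<phi> x else 0) = 0" for x
      using partial_deriv_eq_0_outside[OF \<phi>, of x 1] closure_subset[of "{x \<in> S. f x \<noteq> 0}"]
      by auto
    then have "l2_inner (class_on S f) (class_on S (partial_deriv 1 \<phi>)) = 0"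
      unfolding class_on_def l2_inner_abs_aefun by (simp only: integral_zero)
    then show "l2_inner (abs_aefun g) (class_on S \<phi>) = 0"
      using w(2) \<phi>' by (simp add: is_weak_deriv_def flip: g(1))
  qed
  then have "AE x in lebesgue. x \<notin> S \<inter> closure {x \<in> S. f x \<noteq> 0} \<longrightarrow> g x = 0"
    by eventually_elim (use g(2) in blast)
  with g(1) show ?thesis by (rule that)
qed

section \<open>Dimensions of tensor product spaces\<close>

lemma edim_le_card:
  assumes "finite B" "U \<subseteq> span B"
  shows "edim U \<le> ereal (card B)"
  using assms dim_le_card[of U B] by (auto simp: edim_def)

lemma edim_nonneg: "edim U \<ge> 0"
  by (simp add: edim_def)

lemma edim_finite_basis:
  assumes "edim U \<noteq> \<infinity>"
  obtains B where "finite B" "B \<subseteq> U" "independent B" "U \<subseteq> span B" "edim U = ereal (card B)"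
proof -
  obtain A where A: "finite A" "U \<subseteq> span A"
    using assms by (auto simp: edim_def split: if_splits)
  obtain B where B: "B \<subseteq> U" "independent B" "U \<subseteq> span B" "card B = dim U"
    by (rule basis_exists)
  with A have "finite B" using independent_span_bound[of A B] by auto
  with B show ?thesis using A by (intro that[of B]) (auto simp: edim_def)
qed

lemma card_independent_le_edim:
  assumes "independent T" "T \<subseteq> U" "edim U \<noteq> \<infinity>"
  shows "finite T \<and> ereal (card T) \<le> edim U"
proof -
  obtain B where "finite B" "U \<subseteq> span B" "edim U = ereal (card B)"
    using edim_finite_basis[OF assms(3)] by metis
  with independent_span_bound[of B T] assms show ?thesis by auto
qed

lemma edim_mono:
  assumes "U \<subseteq> U'"
  shows "edim U \<le> edim U'"
proof (cases "edim U' = \<infinity>")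
  case False
  then obtain B where "finite B" "U' \<subseteq> span B" "edim U' = ereal (card B)"
    using edim_finite_basis by metis
  then show ?thesis using edim_le_card[of B U] assms by auto
qed simp

lemma edim_linear_image_le:
  assumes "linear f"
  shows "edim (f ` U) \<le> edim U"
proof (cases "edim U = \<infinity>")
  case False
  then obtain B where B: "finite B" "U \<subseteq> span B" "edim U = ereal (card B)"
    using edim_finite_basis by metis
  then have "f ` U \<subseteq> span (f ` B)"
    by (auto simp: linear_span_image[OF assms])
  with B have "edim (f ` U) \<le> ereal (card (f ` B))" by (intro edim_le_card) auto
  also have "\<dots> \<le> edim U" using B card_image_le[of B f] by simp
  finally show ?thesis .
qed simp

text \<open>An infinite summand makes the right-hand side infinite; otherwise the union of finite
  bases spans.\<close>

lemma edim_span_UN_le: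
  assumes A: "finite A"
  shows "edim (span (\<Union>i\<in>A. U i)) \<le> (\<Sum>i\<in>A. edim (U i))"
proof (cases "\<exists>i\<in>A. edim (U i) = \<infinity>")
  case True
  then have "(\<Sum>i\<in>A. edim (U i)) = \<infinity>"
    using A by (auto simp: sum_Pinfty)
  then show ?thesis by simp
next
  case False
  then have "\<forall>i\<in>A. \<exists>B. finite B \<and> U i \<subseteq> span B \<and> edim (U i) = ereal (card B)"
    using edim_finite_basis by metis
  then obtain B where B: "\<And>i. i \<in> A \<Longrightarrow> finite (B i) \<and> U i \<subseteq> span (B i) \<and> edim (U i) = ereal (card (B i))"
    by metis
  have "span (\<Union>i\<in>A. U i) \<subseteq> span (\<Union>i\<in>A. B i)"
  proof (rule span_minimal)
    show "(\<Union>i\<in>A. U i) \<subseteq> span (\<Union>i\<in>A. B i)"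
      using B span_mono[of "B _" "\<Union>i\<in>A. B i"] by blast
  qed simp
  then have "edim (span (\<Union>i\<in>A. U i)) \<le> ereal (card (\<Union>i\<in>A. B i))"
    using A B by (intro edim_le_card) auto
  also have "\<dots> \<le> ereal (\<Sum>i\<in>A. real (card (B i)))"
    using card_UN_le[OF A, of B] by (simp flip: of_nat_sum)
  also have "\<dots> = (\<Sum>i\<in>A. edim (U i))"
    using B by (simp flip: sum_ereal)
  finally show ?thesis .
qed

text \<open>Distributivity of extended reals is available here because the terms are nonnegative.
  For infinite \<open>A\<close> both sides are 0, since \<open>card A = 0\<close> and
  \<open>0 * \<infinity> = 0\<close>.\<close>

lemma sum_constant_ereal_nonneg:
  fixes x :: ereal
  assumes "x \<ge> 0"
  shows "(\<Sum>i\<in>A. x) = ereal (card A) * x"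
proof (induction A rule: infinite_finite_induct)
  case (insert i A)
  have "ereal (card (insert i A)) * x = (1 + ereal (card A)) * x"
    using insert.hyps by (simp add: one_ereal_def)
  also have "\<dots> = x + ereal (card A) * x"
    by (subst ereal_left_distrib) auto
  finally show ?case using insert by simp
qed (simp_all flip: zero_ereal_def)

section \<open>Fubini and linear independence of elementary tensors\<close>

lemma AE_lebesgue_Pair:
  assumes "AE z in (lebesgue :: ('a::euclidean_space \<times> 'b::euclidean_space) measure). P z"
  shows "AE y in lebesgue. AE x in lebesgue. P (x, y)"
proof -
  from assms have "AE z in (lborel \<Otimes>\<^sub>M lborel :: ('a \<times> 'b) measure). P z"
    by (simp only: AE_completion_iff lborel_prod)
  then obtain N where N: "N \<in> null_sets (lborel \<Otimes>\<^sub>M lborel :: ('a \<times> 'b) measure)" "{z. \<not> P z} \<subseteq> N"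
    unfolding eventually_ae_filter by (auto simp: space_pair_measure)
  \<comment> \<open>Exchanging the two quantifiers requires a measurable set, so \<open>P\<close> is
    replaced by the complement of a measurable null set \<open>N\<close>.\<close>
  have "AE z in (lborel \<Otimes>\<^sub>M lborel :: ('a \<times> 'b) measure). z \<notin> N"
    using N(1) by (rule AE_not_in)
  then have "AE x in lborel. AE y in (lborel :: 'b measure). (x :: 'a, y) \<notin> N"
    by (rule lborel_pair.AE_pair)
  then have "AE y in lborel. AE x in (lborel :: 'a measure). (x, y :: 'b) \<notin> N"
  proof (subst lborel_pair.AE_commute[symmetric])
    have "{z \<in> space (lborel \<Otimes>\<^sub>M lborel). z \<notin> N} = space (lborel \<Otimes>\<^sub>M lborel) - N" by auto
    then show "{z \<in> space (lborel \<Otimes>\<^sub>M lborel). (fst z, snd z) \<notin> N} \<in> sets (lborel \<Otimes>\<^sub>M lborel)"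
      using sets.compl_sets[OF null_setsD2[OF N(1)]] by (simp only: prod.collapse)
  qed
  then have "AE y in lborel. AE x in (lborel :: 'a measure). P (x, y)"
    using N(2) by (auto elim!: eventually_mono)
  then show ?thesis by (simp only: AE_completion_iff)
qed

lemma sum_abs_aefun:
  assumes "finite F"
  shows "(\<Sum>i\<in>F. abs_aefun (f i)) = abs_aefun (\<lambda>x. \<Sum>i\<in>F. f i x)"
  using assms
  by (induction F) (simp_all add: zero_aefun.abs_eq plus_aefun.abs_eq)

lemma abs_aefun_eq_0_iff: "abs_aefun f = 0 \<longleftrightarrow> (AE x in lebesgue. f x = 0)"
  by (simp add: zero_aefun_def aefun.abs_eq_iff ae_eq_def)

lemma linear_tensor: "linear (tensor e)"
proof (rule linearI)
  show "tensor e (u + v) = tensor e u + tensor e v" for u v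
    by transfer (simp add: ae_eq_def case_prod_beta algebra_simps)
  show "tensor e (c *\<^sub>R u) = c *\<^sub>R tensor e u" for c u
    by transfer (simp add: ae_eq_def case_prod_beta algebra_simps)
qed

text \<open>
  By Fubini, for almost every \<open>x\<close> the combination of the \<open>e i\<close> with coefficients \<open>w i x\<close> vanishes.
\<close>

lemma sum_tensor_eq_0:
  assumes F: "finite F" and indep: "\<And>c. (\<Sum>i\<in>F. c i *\<^sub>R e i) = 0 \<Longrightarrow> \<forall>i\<in>F. c i = 0"
    and 0: "(\<Sum>i\<in>F. tensor (e i) (w i)) = 0"
  shows "\<forall>i\<in>F. w i = 0"
proof -
  define f where "f i = rep_aefun (e i)" for i
  define g where "g i = rep_aefun (w i)" for i
  have e: "e i = abs_aefun (f i)" and w: "w i = abs_aefun (g i)" for i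
    by (simp_all add: f_def g_def Quotient3_abs_rep[OF Quotient3_aefun])
  have "AE z in lebesgue. (\<Sum>i\<in>F. case z of (t, x) \<Rightarrow> f i t * g i x) = 0"
    using 0 by (simp add: e w tensor.abs_eq sum_abs_aefun[OF F] abs_aefun_eq_0_iff)
  then have "AE x in lebesgue. AE t in lebesgue. (\<Sum>i\<in>F. f i t * g i x) = 0"
    by (auto dest: AE_lebesgue_Pair)
  then have "AE x in lebesgue. \<forall>i\<in>F. g i x = 0"
  proof eventually_elim
    case (elim x)
    then have "(\<Sum>i\<in>F. g i x *\<^sub>R e i) = 0"
      by (simp add: e scaleR_aefun.abs_eq sum_abs_aefun[OF F] abs_aefun_eq_0_iff mult.commute)
    then show ?case by (rule indep)
  qed
  then have "AE x in lebesgue. g i x = 0" if "i \<in> F" for i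
    using that by (auto elim: eventually_mono)
  then show ?thesis by (simp add: w abs_aefun_eq_0_iff)
qed

text \<open>Bases of the \<open>U i\<close>, tensored with the \<open>e i\<close>, form one
  independent family in \<open>X\<close>, whose size is the left-hand side. Each \<open>U i\<close>
  is finite-dimensional when \<open>edim X\<close> is finite, because tensoring with
  \<open>e i\<close> is injective.\<close>

lemma sum_edim_le_edim_tensor:
  fixes e :: "'i \<Rightarrow> real aefun" and U :: "'i \<Rightarrow> 'a::euclidean_space aefun set"
  assumes indep: "\<And>F c. finite F \<Longrightarrow> (\<Sum>i\<in>F. c i *\<^sub>R e i) = 0 \<Longrightarrow> \<forall>i\<in>F. c i = 0"
    and L: "finite L" and U: "\<And>i. i \<in> L \<Longrightarrow> subspace (U i)"
    and X: "\<And>i. i \<in> L \<Longrightarrow> tensor (e i) ` U i \<subseteq> X"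
  shows "(\<Sum>i\<in>L. edim (U i)) \<le> edim X"
proof (cases "edim X = \<infinity>")
  case False
  have "edim (U i) \<noteq> \<infinity>" if i: "i \<in> L" for i
  proof -
    have "v = 0" if "tensor (e i) v = 0" for v :: "'a aefun"
    proof -
      have "(\<Sum>j\<in>{i}. tensor (e j) v) = 0" using that by simp
      from sum_tensor_eq_0[OF _ indep this] show ?thesis by simp
    qed
    then have inj: "inj (tensor (e i) :: 'a aefun \<Rightarrow> _)"
      by (simp add: linear_injective_0[OF linear_tensor])
    obtain B where B: "B \<subseteq> U i" "independent B" "U i \<subseteq> span B"
      by (rule basis_exists)
    have "independent (tensor (e i) ` B)"
      by (rule linear_independent_injective_image[OF linear_tensor B(2) inj_on_subset[OF inj subset_UNIV]])
    moreover have "tensor (e i) ` B \<subseteq> X" using B(1) X[OF i] by blast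
    ultimately have "finite (tensor (e i) ` B)"
      using card_independent_le_edim False by blast
    then have "finite B" by (rule finite_imageD) (rule inj_on_subset[OF inj subset_UNIV])
    then show ?thesis using edim_le_card[of B "U i"] B by auto
  qed
  then have "\<forall>i\<in>L. \<exists>B. finite B \<and> B \<subseteq> U i \<and> independent B \<and> edim (U i) = ereal (card B)"
    using edim_finite_basis by metis
  then obtain B where B: "\<And>i. i \<in> L \<Longrightarrow> finite (B i)" "\<And>i. i \<in> L \<Longrightarrow> B i \<subseteq> U i"
    "\<And>i. i \<in> L \<Longrightarrow> independent (B i)" "\<And>i. i \<in> L \<Longrightarrow> edim (U i) = ereal (card (B i))"
    by metis
  define T where "T = Sigma L B"
  define f where "f = (\<lambda>(i, v :: 'a aefun). tensor (e i) v)"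
  have T: "finite T" using L B by (simp add: T_def)
  \<comment> \<open>Collecting the terms with equal \<open>i\<close> reduces independence of the
    family indexed by pairs first to that of \<open>e\<close>, then to that of each
    \<open>B i\<close>.\<close>
  have comb: "\<forall>p\<in>T. c p = 0" if c: "(\<Sum>p\<in>T. c p *\<^sub>R f p) = 0" for c
  proof -
    have "(\<Sum>p\<in>T. c p *\<^sub>R f p) = (\<Sum>i\<in>L. \<Sum>v\<in>B i. c (i, v) *\<^sub>R tensor (e i) v)"
      unfolding T_def f_def using L B by (subst sum.Sigma) (auto intro!: sum.cong)
    also have "\<dots> = (\<Sum>i\<in>L. tensor (e i) (\<Sum>v\<in>B i. c (i, v) *\<^sub>R v))"
      by (simp add: linear_sum[OF linear_tensor] linear_cmul[OF linear_tensor])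
    finally have "(\<Sum>i\<in>L. tensor (e i) (\<Sum>v\<in>B i. c (i, v) *\<^sub>R v)) = 0"
      using c by simp
    then have "\<forall>i\<in>L. (\<Sum>v\<in>B i. c (i, v) *\<^sub>R v) = 0"
      using sum_tensor_eq_0[where w = "\<lambda>i. \<Sum>v\<in>B i. c (i, v) *\<^sub>R v", OF L] indep[OF L] by blast
    then have "c (i, v) = 0" if "i \<in> L" "v \<in> B i" for i v
      using independentD[OF B(3)[OF that(1)] B(1)[OF that(1)] order_refl, of "\<lambda>v. c (i, v)" v] that
      by blast
    then show ?thesis by (auto simp: T_def)
  qed
  have inj: "inj_on f T"
  proof (rule inj_onI, rule ccontr)
    fix p q assume pq: "p \<in> T" "q \<in> T" "f p = f q" "p \<noteq> q"
    \<comment> \<open>Two pairs with the same image would give a vanishing combination with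
      coefficients 1 and -1.\<close>
    define c where "c r = (if r = p then 1 else if r = q then - 1 else 0 :: real)" for r
    have "(\<Sum>r\<in>T. c r *\<^sub>R f r) = (\<Sum>r\<in>{p, q}. c r *\<^sub>R f r)"
      using T pq by (intro sum.mono_neutral_right) (auto simp: c_def)
    also have "\<dots> = 0" using pq by (simp add: c_def)
    finally have "c p = 0" using comb pq by blast
    then show False by (simp add: c_def)
  qed
  have "independent (f ` T)"
    unfolding dependent_finite[OF finite_imageI[OF T]]
  proof safe
    fix u p assume "(\<Sum>v\<in>f ` T. u v *\<^sub>R v) = 0" "p \<in> T" "u (f p) \<noteq> 0"
    then show False using comb[of "u \<circ> f"] by (simp add: sum.reindex[OF inj] o_def)
  qed
  moreover have "f ` T \<subseteq> X"
  proof safe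
    fix i v assume "(i, v) \<in> T"
    then have "i \<in> L" "v \<in> U i" using B(2) by (auto simp: T_def)
    then show "f (i, v) \<in> X" using X by (auto simp: f_def)
  qed
  ultimately have "ereal (card (f ` T)) \<le> edim X"
    using card_independent_le_edim[OF _ _ False] by blast
  moreover have "card (f ` T) = (\<Sum>i\<in>L. card (B i))"
    using L B(1) by (subst card_image[OF inj]) (simp add: T_def card_SigmaI)
  then have "ereal (card (f ` T)) = (\<Sum>i\<in>L. edim (U i))"
    by (simp add: B(4))
  ultimately show ?thesis by simp
qed simp

section \<open>Overlapping wavelets\<close>

lemma supp_I_sets [measurable]: "supp_I f \<in> sets lebesgue"
  unfolding supp_I_def unit_I_def by auto

text \<open>If the overlap were null, the integrand would vanish almost everywhere. A weak
  derivative is known only almost everywhere, so a set \<open>A\<close> off which \<open>g\<close>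
  vanishes almost everywhere takes the place of its support.\<close>

lemma l2_inner_neq_0_imp_overlap:
  assumes g: "AE x in lebesgue. x \<notin> A \<longrightarrow> g x = 0" and A: "A \<in> sets lebesgue"
    and neq: "l2_inner (abs_aefun g) (cl f) \<noteq> 0"
  shows "emeasure lebesgue (A \<inter> supp_I f) > 0"
proof (rule ccontr)
  assume "\<not> ?thesis"
  then have "A \<inter> supp_I f \<in> null_sets lebesgue"
    using A supp_I_sets[of f] by (intro null_setsI) auto
  then have "AE x in lebesgue. x \<notin> A \<inter> supp_I f" by (rule AE_not_in)
  with g have "AE x in lebesgue. g x * (if x \<in> unit_I then f x else 0) = 0"
  proof eventually_elim
    case (elim x)
    have "x \<in> supp_I f" if "x \<in> unit_I" "f x \<noteq> 0"
      using that closure_subset[of "{x \<in> unit_I. f x \<noteq> 0}"] by (auto simp: supp_I_def)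
    with elim show ?case by auto
  qed
  then have "(LINT x|lebesgue. g x * (if x \<in> unit_I then f x else 0)) = 0"
    by (rule integral_eq_zero_AE)
  with neq show False by (simp add: class_on_def l2_inner_abs_aefun)
qed

lemma l2_inner_cl_neq_0_imp_overlap:
  assumes "l2_inner (cl f) (cl g) \<noteq> 0"
  shows "emeasure lebesgue (supp_I f \<inter> supp_I g) > 0"
proof (rule l2_inner_neq_0_imp_overlap[OF _ supp_I_sets])
  show "AE x in lebesgue. x \<notin> supp_I f \<longrightarrow> (if x \<in> unit_I then f x else 0) = 0"
    using closure_subset[of "{x \<in> unit_I. f x \<noteq> 0}"] by (intro AE_I2) (auto simp: supp_I_def)
  show "l2_inner (abs_aefun (\<lambda>x. if x \<in> unit_I then f x else 0)) (cl g) \<noteq> 0"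
    using assms by (simp add: class_on_def)
qed

lemma l2_inner_cl_deriv_neq_0_imp_overlap:
  assumes f: "cl f \<in> H1 unit_I" and neq: "l2_inner (cl_deriv f) (cl g) \<noteq> 0"
  shows "emeasure lebesgue (supp_I f \<inter> supp_I g) > 0"
proof -
  have "open unit_I" "bounded unit_I" by (auto simp: unit_I_def)
  then obtain h where "cl_deriv f = abs_aefun h"
    "AE x in lebesgue. x \<notin> unit_I \<inter> closure {x \<in> unit_I. f x \<noteq> 0} \<longrightarrow> h x = 0"
    using weak_deriv_AE_0[OF _ _ f] by blast
  then show ?thesis
    using neq l2_inner_neq_0_imp_overlap[OF _ supp_I_sets, of f h g] by (simp add: supp_I_def)
qed

text \<open>Every generator of the span is orthogonal to the higher-level
  \<open>\<psi> \<mu>\<close>, and the orthogonal complement within \<open>L2 unit_I\<close> is a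
  subspace.\<close>

lemma l2_inner_span_level_eq_0:
  assumes on: "orthonormal_basis_L2 unit_I (\<lambda>m. cl (\<psi> m))"
    and u: "u \<in> span {cl (\<psi> m) | m. lev m \<le> k}" and \<mu>: "lev \<mu> > (k :: nat)"
  shows "l2_inner u (cl (\<psi> \<mu>)) = 0"
proof -
  have I: "unit_I \<in> sets lebesgue" by (simp add: unit_I_def)
  have L2: "cl (\<psi> m) \<in> L2 unit_I" for m
    using on unfolding orthonormal_basis_L2_def by blast
  have "span {cl (\<psi> m) | m. lev m \<le> k} \<subseteq> {u \<in> L2 unit_I. l2_inner u (cl (\<psi> \<mu>)) = 0}"
  proof (rule span_minimal[OF _ subspace_l2_orthogonal[OF L2 I]], safe)
    fix m assume "lev m \<le> k"
    then have "m \<noteq> \<mu>" using \<mu> by auto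
    then show "l2_inner (cl (\<psi> m)) (cl (\<psi> \<mu>)) = 0"
      using on unfolding orthonormal_basis_L2_def by simp
  qed (rule L2)
  with u show ?thesis by blast
qed

section \<open>Locality: counting the wavelets near a given one\<close>

lemma finite_card_nat_near:
  fixes y r :: real
  assumes "r \<ge> 0"
  shows "finite {n. \<bar>real n - y\<bar> \<le> r} \<and> card {n. \<bar>real n - y\<bar> \<le> r} \<le> nat \<lceil>2 * r\<rceil> + 2"
proof -
  \<comment> \<open>Here \<open>nat\<close> turns a negative lower end into 0, which loses no
    natural number.\<close>
  let ?a = "nat \<lfloor>y - r\<rfloor>"
  have "{n. \<bar>real n - y\<bar> \<le> r} \<subseteq> {?a..?a + nat \<lceil>2 * r\<rceil> + 1}"
  proof
    fix n assume "n \<in> {n. \<bar>real n - y\<bar> \<le> r}"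
    then have n: "y - r \<le> real n" "real n \<le> y + r" by auto
    have "real n \<le> real ?a + real (nat \<lceil>2 * r\<rceil>) + 1"
      using n assms by linarith
    moreover have "real ?a \<le> real n" using n by linarith
    ultimately show "n \<in> {?a..?a + nat \<lceil>2 * r\<rceil> + 1}" by simp
  qed
  from finite_subset[OF this] card_mono[OF _ this] show ?thesis by auto
qed

text \<open>If \<open>N m\<close> meets \<open>N' l\<close> on level \<open>k\<close>, then all of
  \<open>supp_I (\<psi> m)\<close> lies within \<open>(C + C') / 2 ^ k\<close> of a fixed point of
  \<open>N' l\<close>. Boundedly many dyadic intervals cover that region; the support meets one of
  them in positive measure, and each admits at most \<open>M\<close> indices.\<close>

lemma wavelet_overlap_card_bounded:
  fixes lev :: "'m::countable \<Rightarrow> nat" and lev' :: "'l::countable \<Rightarrow> nat"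
  assumes wc: "wavelet_collection lev \<psi> par N" and wc': "wavelet_collection lev' \<sigma> par' N'"
    and pos: "\<And>m. emeasure lebesgue (supp_I (\<psi> m)) > 0"
  obtains K :: nat where "\<And>l. finite {m. lev m = lev' l \<and> emeasure lebesgue (N m \<inter> N' l) > 0}"
    "\<And>l. card {m. lev m = lev' l \<and> emeasure lebesgue (N m \<inter> N' l) > 0} \<le> K"
proof -
  let ?J = "\<lambda>(n::nat) k. {real n / 2 ^ k .. (real n + 1) / 2 ^ k}"
  let ?A = "\<lambda>n k. {m. lev m = k \<and> emeasure lebesgue (supp_I (\<psi> m) \<inter> ?J n k) > 0}"
  obtain M where M: "\<And>n k. finite (?A n k) \<and> card (?A n k) \<le> M"
    using wc unfolding wavelet_collection_def Let_def by blast
  obtain C where C: "\<And>m. diameter (N m) \<le> C / 2 ^ lev m"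
    using wc unfolding wavelet_collection_def by blast
  obtain C' where C': "\<And>l. diameter (N' l) \<le> C' / 2 ^ lev' l"
    using wc' unfolding wavelet_collection_def by blast
  have bdd: "bounded (N m)" "bounded (N' l)" for m l
    using wc wc' unfolding wavelet_collection_def by blast+
  have supp: "supp_I (\<psi> m) \<subseteq> N m" for m
    using wc interior_subset[of "N m"] unfolding wavelet_collection_def by blast
  \<comment> \<open>The extra 1 pays for rounding \<open>2 ^ k * z\<close> down to an integer; the
    absolute value keeps \<open>r\<close> nonnegative.\<close>
  define r where "r = \<bar>C + C'\<bar> + 1"
  let ?K = "(nat \<lceil>2 * r\<rceil> + 2) * M"
  have "finite {m. lev m = lev' l \<and> emeasure lebesgue (N m \<inter> N' l) > 0} \<and>
      card {m. lev m = lev' l \<and> emeasure lebesgue (N m \<inter> N' l) > 0} \<le> ?K" for l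
  proof (cases "N' l = {}")
    case False
    then obtain x where x: "x \<in> N' l" by blast
    define k where "k = lev' l"
    define Q where "Q = {n. \<bar>real n - 2 ^ k * x\<bar> \<le> r}"
    have Q: "finite Q" "card Q \<le> nat \<lceil>2 * r\<rceil> + 2"
      using finite_card_nat_near[of r "2 ^ k * x"] by (auto simp: Q_def r_def)
    have sub: "{m. lev m = lev' l \<and> emeasure lebesgue (N m \<inter> N' l) > 0} \<subseteq> (\<Union>n\<in>Q. ?A n k)"
    proof safe
      fix m assume m: "lev m = lev' l" "emeasure lebesgue (N m \<inter> N' l) > 0"
      then obtain y where y: "y \<in> N m" "y \<in> N' l"
        by (metis emeasure_empty less_irrefl IntE equals0I)
      have cover: "supp_I (\<psi> m) \<subseteq> (\<Union>n\<in>Q. supp_I (\<psi> m) \<inter> ?J n k)"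
      proof
        fix z assume z: "z \<in> supp_I (\<psi> m)"
        then have z0: "z > 0" by (simp add: supp_I_def unit_I_def)
        have "\<bar>z - x\<bar> \<le> dist z y + dist y x" by (simp add: dist_real_def)
        also have "\<dots> \<le> diameter (N m) + diameter (N' l)"
          using z supp[of m] x y by (intro add_mono diameter_bounded_bound bdd) auto
        also have "\<dots> \<le> (C + C') / 2 ^ k"
          using C[of m] C'[of l] m(1) by (simp add: k_def add_divide_distrib)
        also have "\<dots> \<le> \<bar>C + C'\<bar> / 2 ^ k" by (intro divide_right_mono) auto
        finally have "2 ^ k * \<bar>z - x\<bar> \<le> \<bar>C + C'\<bar>" by (simp add: field_simps)
        then have zx: "\<bar>2 ^ k * z - 2 ^ k * x\<bar> \<le> \<bar>C + C'\<bar>"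
          by (simp add: abs_mult flip: right_diff_distrib)
        \<comment> \<open>The index of a dyadic interval containing \<open>z\<close>; since
          \<open>z > 0\<close>, the conversion by \<open>nat\<close> changes nothing.\<close>
        define n where "n = nat \<lfloor>2 ^ k * z\<rfloor>"
        have n: "real n \<le> 2 ^ k * z" "2 ^ k * z \<le> real n + 1"
          using z0 by (auto simp: n_def)
        then have "n \<in> Q" using zx by (auto simp: Q_def r_def)
        moreover have "z \<in> ?J n k" using n by (simp add: field_simps)
        ultimately show "z \<in> (\<Union>n\<in>Q. supp_I (\<psi> m) \<inter> ?J n k)" using z by blast
      qed
      \<comment> \<open>Otherwise the support would be covered by finitely many null sets, contrary
        to \<open>pos\<close>.\<close>
      have "\<exists>n\<in>Q. emeasure lebesgue (supp_I (\<psi> m) \<inter> ?J n k) > 0"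
      proof (rule ccontr)
        assume "\<not> ?thesis"
        then have "(\<Union>n\<in>Q. supp_I (\<psi> m) \<inter> ?J n k) \<in> null_sets lebesgue"
          using Q(1) by (intro null_sets_UN' countable_finite null_setsI) (auto simp: not_less)
        then have "supp_I (\<psi> m) \<in> null_sets lebesgue"
          by (rule null_sets_subset[OF _ supp_I_sets cover])
        then show False using pos[of m] by auto
      qed
      then show "m \<in> (\<Union>n\<in>Q. ?A n k)" using m(1) by (auto simp: k_def)
    qed
    have fin: "finite (\<Union>n\<in>Q. ?A n k)" using Q(1) M by blast
    have "card (\<Union>n\<in>Q. ?A n k) \<le> (\<Sum>n\<in>Q. card (?A n k))"
      by (rule card_UN_le[OF Q(1)])
    also have "\<dots> \<le> card Q * M"
      using sum_mono[of Q "\<lambda>n. card (?A n k)" "\<lambda>_. M"] M by simp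
    also have "\<dots> \<le> ?K" using Q(2) by (rule mult_right_mono) simp
    finally have "card (\<Union>n\<in>Q. ?A n k) \<le> ?K" .
    with card_mono[OF fin sub] finite_subset[OF sub fin] show ?thesis by linarith
  qed simp
  then show ?thesis using that by blast
qed

section \<open>Trial and test spaces\<close>

text \<open>The lower Riesz bound makes all coefficients of a vanishing combination zero. In
  \<open>riesz_basis\<close> the function \<open>nrm\<close> is arbitrary, hence the assumption on
  its value at 0.\<close>

lemma riesz_basis_independent:
  assumes rb: "riesz_basis X nrm e" and nrm: "nrm 0 = 0"
    and F: "finite F" and 0: "(\<Sum>i\<in>F. c i *\<^sub>R e i) = 0"
  shows "\<forall>i\<in>F. c i = 0"
proof -
  obtain a where a: "a > 0"
    "\<And>F c. finite F \<Longrightarrow> a * sqrt (\<Sum>i\<in>F. (c i)\<^sup>2) \<le> nrm (\<Sum>i\<in>F. c i *\<^sub>R e i)"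
    using rb unfolding riesz_basis_def by blast
  have "a * sqrt (\<Sum>i\<in>F. (c i)\<^sup>2) \<le> 0"
    using a(2)[OF F, of c] by (simp add: 0 nrm)
  then have "(\<Sum>i\<in>F. (c i)\<^sup>2) \<le> 0" using a(1) by (simp add: mult_le_0_iff)
  then have "(\<Sum>i\<in>F. (c i)\<^sup>2) = 0" by (intro antisym sum_nonneg) auto
  then show ?thesis using F by (simp add: sum_nonneg_eq_0_iff)
qed

section \<open>Ancestors and the spaces \<open>breve\<close>\<close>

lemma wavelet_ancestor_exists:
  assumes wc: "wavelet_collection lev f par N" and tree: "\<And>p l. par p l \<Longrightarrow> W l \<subseteq> W p"
    and "k \<le> lev l"
  shows "\<exists>a. lev a = k \<and> N l \<subseteq> N a \<and> W l \<subseteq> W a"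
  using \<open>k \<le> lev l\<close>
proof (induction "lev l" arbitrary: l)
  case 0
  then show ?case by auto
next
  case (Suc n)
  show ?case
  proof (cases "k = lev l")
    case False
    obtain p where p: "par p l"
      using wc Suc.hyps(2) unfolding wavelet_collection_def by (metis zero_less_Suc)
    then have "lev l = lev p + 1" "N l \<subseteq> N p"
      using wc unfolding wavelet_collection_def by blast+
    moreover from this obtain a where "lev a = k" "N p \<subseteq> N a" "W p \<subseteq> W a"
      using Suc False by force
    ultimately show ?thesis using tree[OF p] by blast
  qed auto
qed

text \<open>The ancestor of \<open>l\<close> on level \<open>lev' m\<close> inherits the overlap
  with \<open>N' m\<close>, as its neighbourhood is larger. It therefore indexes a summand of
  \<open>breve\<close>, and its space contains \<open>W l\<close>.\<close>

lemma subset_breve: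
  assumes wc: "wavelet_collection lev f par N" and tree: "\<And>p l. par p l \<Longrightarrow> W l \<subseteq> W p"
    and le: "lev' m \<le> lev l" and N': "N' m \<in> sets lebesgue"
    and pos: "emeasure lebesgue (N' m \<inter> N l) > 0"
  shows "W l \<subseteq> breve lev N lev' N' W m"
proof -
  obtain a where a: "lev a = lev' m" "N l \<subseteq> N a" "W l \<subseteq> W a"
    using wavelet_ancestor_exists[where W = W, OF wc tree le] by blast
  have "N a \<in> sets lebesgue" using wc unfolding wavelet_collection_def by blast
  then have "emeasure lebesgue (N' m \<inter> N l) \<le> emeasure lebesgue (N' m \<inter> N a)"
    using a(2) N' by (intro emeasure_mono) auto
  with pos have "0 < emeasure lebesgue (N' m \<inter> N a)" by (rule less_le_trans)
  with a show ?thesis unfolding breve_def by (blast intro: span_base)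
qed

lemma inf_sup_antimono: "W \<subseteq> W' \<Longrightarrow> inf_sup S \<Gamma> W' U \<le> inf_sup S \<Gamma> W U"
  unfolding inf_sup_def by (rule INF_superset_mono) auto

text \<open>The infimum runs over the empty set. This covers trivial trial spaces, where no inf-sup
  bound is assumed.\<close>

lemma inf_sup_subset_0: "W \<subseteq> {0} \<Longrightarrow> inf_sup S \<Gamma> W U = \<infinity>"
  unfolding inf_sup_def by (simp add: top_ereal_def Diff_eq_empty_iff[THEN iffD2])

text \<open>An index \<open>l\<close> that overlaps \<open>m\<close> also overlaps the parent
  \<open>p\<close>, whose neighbourhood is larger. It sits one level too high for
  \<open>breve\<close> at \<open>p\<close>, which \<open>subset_breve\<close> repairs.\<close>

lemma breve_parent_subset:
  assumes wc: "wavelet_collection lev f par N" and wc': "wavelet_collection lev' f' par' N'"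
    and tree: "\<And>p l. par p l \<Longrightarrow> W l \<subseteq> W p" and pm: "par' p m"
  shows "breve lev N lev' N' W m \<subseteq> breve lev N lev' N' W p"
  unfolding breve_def[of _ _ _ _ _ m]
proof (rule span_minimal)
  have p: "lev' m = lev' p + 1" "N' m \<subseteq> N' p" "N' p \<in> sets lebesgue"
    using wc' pm unfolding wavelet_collection_def by blast+
  show "(\<Union>l\<in>{l. lev l = lev' m \<and> emeasure lebesgue (N' m \<inter> N l) > 0}. W l)
      \<subseteq> breve lev N lev' N' W p"
  proof (rule UN_least)
    fix l assume "l \<in> {l. lev l = lev' m \<and> emeasure lebesgue (N' m \<inter> N l) > 0}"
    then have l: "lev l = lev' m" "emeasure lebesgue (N' m \<inter> N l) > 0" by auto
    have "N l \<in> sets lebesgue" using wc unfolding wavelet_collection_def by blast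
    then have "emeasure lebesgue (N' m \<inter> N l) \<le> emeasure lebesgue (N' p \<inter> N l)"
      using p by (intro emeasure_mono) auto
    with l(2) have "emeasure lebesgue (N' p \<inter> N l) > 0" by (rule less_le_trans)
    then show "W l \<subseteq> breve lev N lev' N' W p"
      using l(1) p by (intro subset_breve[OF wc tree]) auto
  qed
qed (simp add: breve_def)

text \<open>A double count over overlapping pairs \<open>(l, m)\<close> of equal level:
  \<open>C\<close> compares \<open>V m\<close> with the sum of the \<open>W l\<close> seen by
  \<open>m\<close>, and \<open>K\<close> bounds how often each \<open>l\<close> is seen.\<close>

lemma edim_tensor_space_le:
  fixes W :: "'l \<Rightarrow> 'a::euclidean_space aefun set" and V :: "'m \<Rightarrow> 'a aefun set"
  assumes rb: "riesz_basis X l2_norm (\<lambda>l. cl (\<sigma> l))"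
    and W: "\<And>l. subspace (W l)" "finite {l. W l \<noteq> {0}}"
    and K: "\<And>l. finite {m. lev' m = lev l \<and> emeasure lebesgue (N' m \<inter> N l) > 0}"
      "\<And>l. card {m. lev' m = lev l \<and> emeasure lebesgue (N' m \<inter> N l) > 0} \<le> K"
    and C: "C > 0" "\<And>m. edim (V m) \<le> ereal C * edim (breve lev N lev' N' W m)"
    and V0: "\<And>m. breve lev N lev' N' W m = {0} \<Longrightarrow> V m = {0}"
  shows "edim (tensor_space \<psi> V) \<le> ereal (C * real K) * edim (tensor_space \<sigma> W)"
proof -
  define L where "L = {l. W l \<noteq> {0}}"
  define ov where "ov l = {m. lev' m = lev l \<and> emeasure lebesgue (N' m \<inter> N l) > 0}" for l
  \<comment> \<open>Only these finitely many \<open>m\<close> can have a non-zero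
    \<open>V m\<close>: for all others \<open>breve\<close> is trivial and \<open>V0\<close>
    applies.\<close>
  define F where "F = (\<Union>l\<in>L. ov l)"
  have L: "finite L" using W(2) by (simp add: L_def)
  have F: "finite F" using L K(1) by (simp add: F_def ov_def)
  have breve: "breve lev N lev' N' W m \<subseteq> span (\<Union>l\<in>{l \<in> L. m \<in> ov l}. W l)" for m
    unfolding breve_def
  proof (rule span_minimal)
    show "(\<Union>l\<in>{l. lev l = lev' m \<and> 0 < emeasure lebesgue (N' m \<inter> N l)}. W l)
        \<subseteq> span (\<Union>l\<in>{l \<in> L. m \<in> ov l}. W l)"
    proof safe
      fix w l assume l: "lev l = lev' m" "0 < emeasure lebesgue (N' m \<inter> N l)" "w \<in> W l"
      show "w \<in> span (\<Union>l\<in>{l \<in> L. m \<in> ov l}. W l)"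
      proof (cases "l \<in> L")
        case True
        then show ?thesis using l by (intro span_base) (auto simp: ov_def)
      next
        case False
        then have "w = 0" using l(3) by (auto simp: L_def)
        then show ?thesis by (simp add: span_zero)
      qed
    qed
  qed simp
  have V_F: "V m = {0}" if "m \<notin> F" for m
  proof (rule V0)
    have "{l \<in> L. m \<in> ov l} = {}" using that by (auto simp: F_def)
    with breve[of m] have "breve lev N lev' N' W m \<subseteq> {0}" by simp
    then show "breve lev N lev' N' W m = {0}" by (auto simp: breve_def span_zero)
  qed
  have "tensor_space \<psi> V \<subseteq> span (\<Union>m\<in>F. tensor (cl (\<psi> m)) ` V m)"
    unfolding tensor_space_def
  proof (rule span_minimal)
    show "(\<Union>m. tensor (cl (\<psi> m)) ` V m) \<subseteq> span (\<Union>m\<in>F. tensor (cl (\<psi> m)) ` V m)"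
    proof safe
      fix m v assume v: "v \<in> V m"
      show "tensor (cl (\<psi> m)) v \<in> span (\<Union>m\<in>F. tensor (cl (\<psi> m)) ` V m)"
      proof (cases "m \<in> F")
        case True
        then show ?thesis using v by (intro span_base) auto
      next
        case False
        then have "v = 0" using V_F v by auto
        then show ?thesis by (simp add: linear_0[OF linear_tensor] span_zero)
      qed
    qed
  qed simp
  then have "edim (tensor_space \<psi> V) \<le> edim (span (\<Union>m\<in>F. tensor (cl (\<psi> m)) ` V m))"
    by (rule edim_mono)
  also have "\<dots> \<le> (\<Sum>m\<in>F. edim (tensor (cl (\<psi> m)) ` V m))"
    by (rule edim_span_UN_le[OF F])
  also have "\<dots> \<le> (\<Sum>m\<in>F. ereal C * (\<Sum>l\<in>{l \<in> L. m \<in> ov l}. edim (W l)))"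
  proof (rule sum_mono)
    fix m
    have "edim (tensor (cl (\<psi> m)) ` V m) \<le> edim (V m)"
      by (rule edim_linear_image_le[OF linear_tensor])
    also have "\<dots> \<le> ereal C * edim (breve lev N lev' N' W m)" by (rule C(2))
    also have "edim (breve lev N lev' N' W m) \<le> edim (span (\<Union>l\<in>{l \<in> L. m \<in> ov l}. W l))"
      by (rule edim_mono[OF breve])
    also have "\<dots> \<le> (\<Sum>l\<in>{l \<in> L. m \<in> ov l}. edim (W l))"
      using L by (intro edim_span_UN_le) simp
    finally show "edim (tensor (cl (\<psi> m)) ` V m) \<le> ereal C * (\<Sum>l\<in>{l \<in> L. m \<in> ov l}. edim (W l))"
      using C(1) by (simp add: ereal_mult_left_mono)
  qed
  also have "\<dots> = ereal C * (\<Sum>m\<in>F. \<Sum>l\<in>{l \<in> L. m \<in> ov l}. edim (W l))"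
    by (subst sum_ereal_right_distrib) (auto intro!: sum_nonneg edim_nonneg)
  \<comment> \<open>After exchanging the sums, the inner sum is constant and has at most
    \<open>K\<close> terms.\<close>
  also have "(\<Sum>m\<in>F. \<Sum>l\<in>{l \<in> L. m \<in> ov l}. edim (W l)) = (\<Sum>l\<in>L. \<Sum>m\<in>{m \<in> F. m \<in> ov l}. edim (W l))"
    by (rule sum.swap_restrict[OF F L])
  also have "\<dots> \<le> (\<Sum>l\<in>L. ereal (real K) * edim (W l))"
  proof (rule sum_mono)
    fix l
    have "card {m \<in> F. m \<in> ov l} \<le> card (ov l)"
      using K(1) by (intro card_mono) (auto simp: ov_def)
    also have "\<dots> \<le> K" using K(2) by (simp add: ov_def)
    finally show "(\<Sum>m\<in>{m \<in> F. m \<in> ov l}. edim (W l)) \<le> ereal (real K) * edim (W l)"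
      by (subst sum_constant_ereal_nonneg) (auto intro!: ereal_mult_right_mono edim_nonneg)
  qed
  also have "\<dots> = ereal (real K) * (\<Sum>l\<in>L. edim (W l))"
    by (rule sum_ereal_right_distrib[symmetric]) (rule edim_nonneg)
  \<comment> \<open>The Riesz basis property enters here, through linear independence of the
    \<open>\<sigma> l\<close>.\<close>
  also have "(\<Sum>l\<in>L. edim (W l)) \<le> edim (tensor_space \<sigma> W)"
  proof -
    have "l2_norm (0 :: real aefun) = 0"
      using l2_inner_scaleR_left[of 0 0 "0 :: real aefun"] by (simp add: l2_norm_def)
    note indep = riesz_basis_independent[OF rb this]
    have sub: "tensor (cl (\<sigma> l)) ` W l \<subseteq> tensor_space \<sigma> W" for l
      unfolding tensor_space_def using span_superset[of "\<Union>l. tensor (cl (\<sigma> l)) ` W l"] by blast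
    show ?thesis
      by (rule sum_edim_le_edim_tensor[where e = "\<lambda>l. cl (\<sigma> l)", OF _ L W(1) sub])
        (rule indep, assumption+)
  qed
  finally have "edim (tensor_space \<psi> V) \<le> ereal C * (ereal (real K) * edim (tensor_space \<sigma> W))"
    using C(1) by (simp add: ereal_mult_left_mono)
  then show ?thesis by (simp add: mult.assoc flip: times_ereal.simps(1))
qed

text \<open>All spaces form families over \<open>\<Delta>\<close>; fixing \<open>\<gamma>\<close>
  and the constants \<open>C\<close> before \<open>\<delta>\<close> expresses that they are
  independent of \<open>\<delta>\<close>.\<close>

theorem proposition5p2:
  fixes \<Omega> \<Gamma>\<^sub>D :: "(real ^ 'n) set"
    and lev\<^sub>\<Sigma> :: "'l::countable \<Rightarrow> nat" and \<sigma> :: "'l \<Rightarrow> real \<Rightarrow> real"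
    and par\<^sub>\<Sigma> :: "'l \<Rightarrow> 'l \<Rightarrow> bool" and S\<^sub>\<Sigma> :: "'l \<Rightarrow> real set"
    and lev\<^sub>\<Psi> :: "'m::countable \<Rightarrow> nat" and \<psi> :: "'m \<Rightarrow> real \<Rightarrow> real"
    and par\<^sub>\<Psi> :: "'m \<Rightarrow> 'm \<Rightarrow> bool" and S\<^sub>\<Psi> :: "'m \<Rightarrow> real set"
    and \<Delta> :: "'d set" and \<gamma> :: real
    and W :: "'d \<Rightarrow> 'l \<Rightarrow> (real ^ 'n) aefun set"
    and V :: "'d \<Rightarrow> 'm \<Rightarrow> (real ^ 'n) aefun set"
    and Wb :: "'d \<Rightarrow> 'm \<Rightarrow> (real ^ 'n) aefun set"
    and X Y :: "'d \<Rightarrow> (real \<times> (real ^ 'n)) aefun set"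
  assumes domain: "open \<Omega>" "connected \<Omega>" "bounded \<Omega>" "\<Omega> \<noteq> {}"
    and bdry: "closed \<Gamma>\<^sub>D" "\<Gamma>\<^sub>D \<subseteq> frontier \<Omega>"
    and trial: "trial_wavelets lev\<^sub>\<Sigma> \<sigma> par\<^sub>\<Sigma> S\<^sub>\<Sigma>"
    and test: "test_wavelets lev\<^sub>\<Psi> \<psi> par\<^sub>\<Psi> S\<^sub>\<Psi>"
    and relation: "\<And>k. span {cl (\<sigma> l) | l. lev\<^sub>\<Sigma> l \<le> k} \<union> span {cl_deriv (\<sigma> l) | l. lev\<^sub>\<Sigma> l \<le> k}
                       \<subseteq> span {cl (\<psi> m) | m. lev\<^sub>\<Psi> m \<le> k}"
    and W_sub: "\<And>\<delta> l. \<delta> \<in> \<Delta> \<Longrightarrow> subspace (W \<delta> l) \<and> W \<delta> l \<subseteq> H1_0 \<Omega> \<Gamma>\<^sub>D"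
    and W_fin: "\<And>\<delta>. \<delta> \<in> \<Delta> \<Longrightarrow> finite {l. W \<delta> l \<noteq> {0}}"
    and W_tree: "\<And>\<delta> p l. \<delta> \<in> \<Delta> \<Longrightarrow> par\<^sub>\<Sigma> p l \<Longrightarrow> W \<delta> p \<supseteq> W \<delta> l"
    and Wb_eq: "\<And>\<delta> m. \<delta> \<in> \<Delta> \<Longrightarrow> Wb \<delta> m = breve lev\<^sub>\<Sigma> S\<^sub>\<Sigma> lev\<^sub>\<Psi> S\<^sub>\<Psi> (W \<delta>) m"
    and gamma: "\<gamma> > 0"
    and V_sub: "\<And>\<delta> m. \<delta> \<in> \<Delta> \<Longrightarrow> subspace (V \<delta> m) \<and> V \<delta> m \<subseteq> H1_0 \<Omega> \<Gamma>\<^sub>D"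
    and V_zero: "\<And>\<delta> m. \<delta> \<in> \<Delta> \<Longrightarrow> Wb \<delta> m = {0} \<Longrightarrow> V \<delta> m = {0}"
    and V_infsup: "\<And>\<delta> m. \<delta> \<in> \<Delta> \<Longrightarrow> Wb \<delta> m \<noteq> {0} \<Longrightarrow>
                     V \<delta> m \<supseteq> Wb \<delta> m \<and> inf_sup \<Omega> \<Gamma>\<^sub>D (Wb \<delta> m) (V \<delta> m) \<ge> ereal \<gamma>"
    and X_eq: "\<And>\<delta>. \<delta> \<in> \<Delta> \<Longrightarrow> X \<delta> = tensor_space \<sigma> (W \<delta>)"
    and Y_eq: "\<And>\<delta>. \<delta> \<in> \<Delta> \<Longrightarrow> Y \<delta> = tensor_space \<psi> (V \<delta>)"
  shows
    "(\<forall>\<delta>\<in>\<Delta>.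
        (\<forall>l m. l2_inner (cl (\<sigma> l)) (cl (\<psi> m)) \<noteq> 0 \<longrightarrow> V \<delta> m \<supseteq> W \<delta> l) \<and>
        (\<forall>m. inf_sup \<Omega> \<Gamma>\<^sub>D
               (span (\<Union>l \<in> {l. l2_inner (cl_deriv (\<sigma> l)) (cl (\<psi> m)) \<noteq> 0}. W \<delta> l)) (V \<delta> m)
             \<ge> ereal \<gamma>)) \<and>
     ((\<exists>C>0. \<forall>\<delta>\<in>\<Delta>. \<forall>m. edim (V \<delta> m) \<le> ereal C * edim (Wb \<delta> m)) \<longrightarrow>
      (\<exists>C>0. \<forall>\<delta>\<in>\<Delta>. edim (Y \<delta>) \<le> ereal C * edim (X \<delta>))) \<and>
     (\<forall>\<delta>\<in>\<Delta>.
        (\<forall>m m'. Wb \<delta> m \<subseteq> Wb \<delta> m' \<longrightarrow> V \<delta> m \<subseteq> V \<delta> m') \<longrightarrow>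
        (\<forall>p m. par\<^sub>\<Psi> p m \<longrightarrow> V \<delta> p \<supseteq> V \<delta> m))"
proof -
  have \<Sigma>: "wavelet_collection lev\<^sub>\<Sigma> \<sigma> par\<^sub>\<Sigma> S\<^sub>\<Sigma>"
    and riesz: "riesz_basis (L2 unit_I) l2_norm (\<lambda>l. cl (\<sigma> l))"
    and H1: "\<And>l. cl (\<sigma> l) \<in> H1 unit_I"
    using trial unfolding trial_wavelets_def by blast+
  have \<Psi>: "wavelet_collection lev\<^sub>\<Psi> \<psi> par\<^sub>\<Psi> S\<^sub>\<Psi>"
    and orth: "orthonormal_basis_L2 unit_I (\<lambda>m. cl (\<psi> m))"
    using test unfolding test_wavelets_def by blast+
  have S\<^sub>\<Psi>: "S\<^sub>\<Psi> m \<in> sets lebesgue" "supp_I (\<psi> m) \<subseteq> S\<^sub>\<Psi> m" for m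
    using \<Psi> interior_subset[of "S\<^sub>\<Psi> m"] unfolding wavelet_collection_def by blast+
  have S\<^sub>\<Sigma>: "S\<^sub>\<Sigma> l \<in> sets lebesgue" "supp_I (\<sigma> l) \<subseteq> S\<^sub>\<Sigma> l" for l
    using \<Sigma> interior_subset[of "S\<^sub>\<Sigma> l"] unfolding wavelet_collection_def by blast+
  \<comment> \<open>By \<open>relation\<close>, both \<open>\<sigma> l\<close> and its derivative
    lie in the span of the \<open>\<psi>\<close> up to the level of \<open>l\<close>, which is
    orthogonal to every \<open>\<psi>\<close> of higher level.\<close>
  have lev_le: "lev\<^sub>\<Psi> m \<le> lev\<^sub>\<Sigma> l"
    if "l2_inner (cl (\<sigma> l)) (cl (\<psi> m)) \<noteq> 0 \<or> l2_inner (cl_deriv (\<sigma> l)) (cl (\<psi> m)) \<noteq> 0" for l m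
  proof (rule ccontr)
    assume *: "\<not> ?thesis"
    have "cl (\<sigma> l) \<in> span {cl (\<sigma> l') | l'. lev\<^sub>\<Sigma> l' \<le> lev\<^sub>\<Sigma> l}"
      "cl_deriv (\<sigma> l) \<in> span {cl_deriv (\<sigma> l') | l'. lev\<^sub>\<Sigma> l' \<le> lev\<^sub>\<Sigma> l}"
      by (rule span_base, blast)+
    then have "cl (\<sigma> l) \<in> span {cl (\<psi> m) | m. lev\<^sub>\<Psi> m \<le> lev\<^sub>\<Sigma> l}"
      "cl_deriv (\<sigma> l) \<in> span {cl (\<psi> m) | m. lev\<^sub>\<Psi> m \<le> lev\<^sub>\<Sigma> l}"
      using relation[of "lev\<^sub>\<Sigma> l"] by blast+
    then show False
      using that l2_inner_span_level_eq_0[OF orth] * by (meson not_le)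
  qed
  \<comment> \<open>Serves both claims of (i), for the functions and for their derivatives.\<close>
  have W_Wb: "W \<delta> l \<subseteq> Wb \<delta> m"
    if \<delta>: "\<delta> \<in> \<Delta>" and neq: "l2_inner (cl (\<sigma> l)) (cl (\<psi> m)) \<noteq> 0 \<or> l2_inner (cl_deriv (\<sigma> l)) (cl (\<psi> m)) \<noteq> 0"
    for \<delta> l m
  proof -
    have "emeasure lebesgue (supp_I (\<sigma> l) \<inter> supp_I (\<psi> m)) > 0"
      using neq l2_inner_cl_neq_0_imp_overlap l2_inner_cl_deriv_neq_0_imp_overlap[OF H1] by blast
    moreover have "emeasure lebesgue (supp_I (\<sigma> l) \<inter> supp_I (\<psi> m)) \<le> emeasure lebesgue (S\<^sub>\<Psi> m \<inter> S\<^sub>\<Sigma> l)"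
      using S\<^sub>\<Psi>[of m] S\<^sub>\<Sigma>[of l] by (intro emeasure_mono) auto
    ultimately have "emeasure lebesgue (S\<^sub>\<Psi> m \<inter> S\<^sub>\<Sigma> l) > 0" by (rule less_le_trans)
    then show ?thesis
      unfolding Wb_eq[OF \<delta>] using W_tree[OF \<delta>] lev_le[OF neq] S\<^sub>\<Psi>(1)
      by (intro subset_breve[OF \<Sigma>])
  qed
  have Wb_V: "Wb \<delta> m \<subseteq> V \<delta> m" if \<delta>: "\<delta> \<in> \<Delta>" for \<delta> m
    using V_infsup[OF \<delta>, of m] V_zero[OF \<delta>, of m] by (cases "Wb \<delta> m = {0}") auto
  have subspace_Wb: "subspace (Wb \<delta> m)" if \<delta>: "\<delta> \<in> \<Delta>" for \<delta> m
    unfolding Wb_eq[OF \<delta>] breve_def by simp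
  have infsup: "inf_sup \<Omega> \<Gamma>\<^sub>D
      (span (\<Union>l \<in> {l. l2_inner (cl_deriv (\<sigma> l)) (cl (\<psi> m)) \<noteq> 0}. W \<delta> l)) (V \<delta> m) \<ge> ereal \<gamma>"
    (is "inf_sup _ _ ?U _ \<ge> _") if \<delta>: "\<delta> \<in> \<Delta>" for \<delta> m
  proof -
    have sub: "?U \<subseteq> Wb \<delta> m"
      using W_Wb[OF \<delta>] by (intro span_minimal subspace_Wb \<delta>) blast
    show ?thesis
    \<comment> \<open>In the trivial case \<open>V_infsup\<close> says nothing, but the infimum over
      the empty set is infinite.\<close>
    proof (cases "Wb \<delta> m = {0}")
      case True
      with sub have "?U \<subseteq> {0}" by simp
      then show ?thesis by (simp only: inf_sup_subset_0) simp
    next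
      case False
      then show ?thesis
        using V_infsup[OF \<delta> False] inf_sup_antimono[OF sub] order_trans by blast
    qed
  qed
  \<comment> \<open>The inner product of \<open>\<psi> m\<close> with itself is 1, so it overlaps
    itself in positive measure.\<close>
  have pos: "emeasure lebesgue (supp_I (\<psi> m)) > 0" for m
    using l2_inner_cl_neq_0_imp_overlap[of "\<psi> m" "\<psi> m"] orth
    by (simp add: orthonormal_basis_L2_def)
  obtain K where K: "\<And>l. finite {m. lev\<^sub>\<Psi> m = lev\<^sub>\<Sigma> l \<and> emeasure lebesgue (S\<^sub>\<Psi> m \<inter> S\<^sub>\<Sigma> l) > 0}"
    "\<And>l. card {m. lev\<^sub>\<Psi> m = lev\<^sub>\<Sigma> l \<and> emeasure lebesgue (S\<^sub>\<Psi> m \<inter> S\<^sub>\<Sigma> l) > 0} \<le> K"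
    using wavelet_overlap_card_bounded[OF \<Psi> \<Sigma> pos] by blast
  have dim: "\<exists>C'>0. \<forall>\<delta>\<in>\<Delta>. edim (Y \<delta>) \<le> ereal C' * edim (X \<delta>)"
    if C: "C > 0" "\<forall>\<delta>\<in>\<Delta>. \<forall>m. edim (V \<delta> m) \<le> ereal C * edim (Wb \<delta> m)" for C
  proof (intro exI conjI ballI)
    \<comment> \<open>\<open>Suc K\<close> in place of \<open>K\<close> keeps the constant positive
      even if \<open>K = 0\<close>.\<close>
    show "C * real (Suc K) > 0" using C(1) by simp
    fix \<delta> assume \<delta>: "\<delta> \<in> \<Delta>"
    show "edim (Y \<delta>) \<le> ereal (C * real (Suc K)) * edim (X \<delta>)"
      unfolding X_eq[OF \<delta>] Y_eq[OF \<delta>]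
    proof (rule edim_tensor_space_le[OF riesz _ W_fin[OF \<delta>] K(1) le_SucI[OF K(2)] C(1)])
      show "subspace (W \<delta> l)" for l using W_sub[OF \<delta>] by blast
      show "edim (V \<delta> m) \<le> ereal C * edim (breve lev\<^sub>\<Sigma> S\<^sub>\<Sigma> lev\<^sub>\<Psi> S\<^sub>\<Psi> (W \<delta>) m)" for m
        using C(2) \<delta> by (simp flip: Wb_eq[OF \<delta>])
      show "V \<delta> m = {0}" if "breve lev\<^sub>\<Sigma> S\<^sub>\<Sigma> lev\<^sub>\<Psi> S\<^sub>\<Psi> (W \<delta>) m = {0}" for m
        using that V_zero[OF \<delta>] by (simp flip: Wb_eq[OF \<delta>])
    qed
  qed
  have tree: "V \<delta> m \<subseteq> V \<delta> p"
    if \<delta>: "\<delta> \<in> \<Delta>" and mono: "\<forall>m m'. Wb \<delta> m \<subseteq> Wb \<delta> m' \<longrightarrow> V \<delta> m \<subseteq> V \<delta> m'" and "par\<^sub>\<Psi> p m" for \<delta> p m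
  proof -
    have "Wb \<delta> m \<subseteq> Wb \<delta> p"
      unfolding Wb_eq[OF \<delta>]
      by (rule breve_parent_subset[OF \<Sigma> \<Psi> W_tree[OF \<delta>] \<open>par\<^sub>\<Psi> p m\<close>])
    with mono show ?thesis by blast
  qed
  show ?thesis
  proof (intro conjI ballI allI impI)
    fix \<delta> l m assume \<delta>: "\<delta> \<in> \<Delta>" and "l2_inner (cl (\<sigma> l)) (cl (\<psi> m)) \<noteq> 0"
    then show "W \<delta> l \<subseteq> V \<delta> m" using W_Wb[OF \<delta>] Wb_V[OF \<delta>] by blast
  next
    assume "\<exists>C>0. \<forall>\<delta>\<in>\<Delta>. \<forall>m. edim (V \<delta> m) \<le> ereal C * edim (Wb \<delta> m)"
    then obtain C where "C > 0" "\<forall>\<delta>\<in>\<Delta>. \<forall>m. edim (V \<delta> m) \<le> ereal C * edim (Wb \<delta> m)" by auto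
    then show "\<exists>C>0. \<forall>\<delta>\<in>\<Delta>. edim (Y \<delta>) \<le> ereal C * edim (X \<delta>)" by (rule dim)
  next
    fix \<delta> m assume "\<delta> \<in> \<Delta>"
    then show "inf_sup \<Omega> \<Gamma>\<^sub>D
        (span (\<Union>l \<in> {l. l2_inner (cl_deriv (\<sigma> l)) (cl (\<psi> m)) \<noteq> 0}. W \<delta> l)) (V \<delta> m) \<ge> ereal \<gamma>"
      by (rule infsup)
  next
    fix \<delta> p m
    assume "\<delta> \<in> \<Delta>" "\<forall>m m'. Wb \<delta> m \<subseteq> Wb \<delta> m' \<longrightarrow> V \<delta> m \<subseteq> V \<delta> m'" "par\<^sub>\<Psi> p m"
    then show "V \<delta> m \<subseteq> V \<delta> p" by (rule tree)
  qed
qed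

end
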